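(* Let $R \subseteq I_1\times\dots\times I_m$ be a multiway relation between sets $I_1,\dots,I_m$. For each $k\in\{1,\dots,m\}$, the projection $I_1\times\dots\times I_m\to I_1\times\dots\times\widehat{I_k}\times\dots\times I_m$ defines a surjective simplicial map $$\varphi_k : \mathrm{Cuboid}(R) \twoheadrightarrow \mathrm{Dowker}_{/I_k}(R)$$ whose geometric realization $|\varphi_k| : |\mathrm{Cuboid}(R)|\to|\mathrm{Dowker}_{/I_k}(R)|$ is a homotopy equivalence. Moreover the diagram formed by the maps $\varphi_1,\dots,\varphi_m$ is functorial in $R$: if $S\subseteq J_1\times\dots\times J_m$ is a multiway relation and $f_k : I_k\to J_k$ ($k=1,\dots,m$) are functions with $(f_1\times\dots\times f_m)(R)\subseteq S$, then $f_1\times\dots\times f_m$ defines a simplicial map $\mathrm{Cuboid}(R)\to\mathrm{Cuboid}(S)$, for each $k$ the map $f_1\times\dots\times\widehat{f_k}\times\dots\times f_m$ defines a simplicial map $\mathrm{Dowker}_{/I_k}(R)\to\mathrm{Dowker}_{/J_k}(S)$, and these simplicial maps commute with the maps $\varphi_k$ for $R$ and for $S$.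
   Context: For a set $I$, $\Delta I$ is the set of non-empty finite subsets of $I$ ordered by inclusion; a simplicial complex on $I$ is a downwardly closed subset of $\Delta I$ (not every element of $I$ need be a vertex). A simplicial map between simplicial complexes $S$ on $I$ and $T$ on $J$ is a function $f:I\to J$ with $f(\sigma)\in T$ for all $\sigma\in S$; it is called surjective if every simplex of $T$ is the image $f(\sigma)$ of some $\sigma\in S$. $|S|$ and $|f|$ denote the usual geometric realizations (with the CW topology). A hat denotes omission. The cuboid complex of $R$ is the simplicial complex on $I_1\times\dots\times I_m$ $$\mathrm{Cuboid}(R) = \{\rho\in\Delta(I_1\times\dots\times I_m) \mid \rho_1\times\dots\times\rho_m\subseteq R\},$$ where $\rho_k\subseteq I_k$ is the projection of $\rho$ to $I_k$. For $i_k\in I_k$, the slice of $R$ at $i_k$ is $R_{i_k} = \{(i_1,\dots,\widehat{i_k},\dots,i_m) \mid (i_1,\dots,i_k,\dots,i_m)\in R\}\subseteq I_1\times\dots\times\widehat{I_k}\times\dots\times I_m$. The $k$-th multiway Dowker complex of $R$ is the simplicial complex on $I_1\times\dots\times\widehat{I_k}\times\dots\times I_m$ $$\mathrm{Dowker}_{/I_k}(R) = \bigcup_{i_k\in I_k}\mathrm{Cuboid}(R_{i_k}).$$ *)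

theory Defs
  imports "HOL-Analysis.Analysis" "HOL-Library.FuncSet"
begin

section \<open>Abstract simplicial complexes and simplicial maps\<close>

definition nonempty_finite_subsets :: "'v set \<Rightarrow> 'v set set"
  where "nonempty_finite_subsets V = {\<sigma>. \<sigma> \<subseteq> V \<and> finite \<sigma> \<and> \<sigma> \<noteq> {}}"

text \<open>
  The library's \<^const>\<open>simplicial_complex\<close> is a finite geometric complex in a Euclidean space;
  here complexes are abstract and may be infinite. Elements of \<open>V\<close> need not be vertices.
\<close>

definition abstract_complex_on :: "'v set \<Rightarrow> 'v set set \<Rightarrow> bool"
  where "abstract_complex_on V S \<longleftrightarrow>
    S \<subseteq> nonempty_finite_subsets V \<and>
    (\<forall>\<sigma>\<in>S. \<forall>\<tau>\<in>nonempty_finite_subsets V. \<tau> \<subseteq> \<sigma> \<longrightarrow> \<tau> \<in> S)"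

definition simplicial_map ::
    "'v set \<Rightarrow> 'v set set \<Rightarrow> 'w set \<Rightarrow> 'w set set \<Rightarrow> ('v \<Rightarrow> 'w) \<Rightarrow> bool"
  where "simplicial_map V S W T f \<longleftrightarrow>
    abstract_complex_on V S \<and> abstract_complex_on W T \<and>
    f \<in> V \<rightarrow> W \<and> (\<forall>\<sigma>\<in>S. f ` \<sigma> \<in> T)"

definition surjective_simplicial_map ::
    "'v set \<Rightarrow> 'v set set \<Rightarrow> 'w set \<Rightarrow> 'w set set \<Rightarrow> ('v \<Rightarrow> 'w) \<Rightarrow> bool"
  where "surjective_simplicial_map V S W T f \<longleftrightarrow>
    simplicial_map V S W T f \<and> (\<forall>\<tau>\<in>T. \<exists>\<sigma>\<in>S. f ` \<sigma> = \<tau>)"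


section \<open>Geometric realization\<close>

text \<open>Points are given by their barycentric coordinates, extended by zero.\<close>

definition closed_simplex :: "'v set \<Rightarrow> ('v \<Rightarrow> real) set"
  where "closed_simplex \<sigma> = {x. (\<forall>v. 0 \<le> x v) \<and> (\<forall>v. v \<notin> \<sigma> \<longrightarrow> x v = 0) \<and> sum x \<sigma> = 1}"

definition realization_open :: "'v set set \<Rightarrow> ('v \<Rightarrow> real) set \<Rightarrow> bool"
  where "realization_open S U \<longleftrightarrow>
    U \<subseteq> (\<Union>\<sigma>\<in>S. closed_simplex \<sigma>) \<and>
    (\<forall>\<sigma>\<in>S. openin (subtopology (powertop_real UNIV) (closed_simplex \<sigma>)) (U \<inter> closed_simplex \<sigma>))"

text \<open>
  The CW (weak) topology. For finite \<open>\<sigma>\<close>, the product topology induces the Euclidean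
  topology on \<open>closed_simplex \<sigma>\<close>; for infinite complexes the weak topology is in general finer
  than the one induced by the product topology on the whole realization.
\<close>

definition realization :: "'v set set \<Rightarrow> ('v \<Rightarrow> real) topology"
  where "realization S = topology (realization_open S)"

lemma istopology_realization_open: "istopology (realization_open S)"
proof -
  have "realization_open S (U \<inter> V)" if "realization_open S U" "realization_open S V" for U V
  proof -
    have "U \<inter> V \<inter> closed_simplex \<sigma> = (U \<inter> closed_simplex \<sigma>) \<inter> (V \<inter> closed_simplex \<sigma>)" for \<sigma>
      by auto
    with that show ?thesis
      unfolding realization_open_def by (metis openin_Int le_infI1)
  qed
  moreover have "realization_open S (\<Union>\<U>)" if "\<forall>U\<in>\<U>. realization_open S U" for \<U>
  proof -
    have "\<Union>\<U> \<inter> closed_simplex \<sigma> = \<Union>((\<lambda>U. U \<inter> closed_simplex \<sigma>) ` \<U>)" for \<sigma>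
      by auto
    moreover have "openin (subtopology (powertop_real UNIV) (closed_simplex \<sigma>))
        (\<Union>((\<lambda>U. U \<inter> closed_simplex \<sigma>) ` \<U>))" if "\<sigma> \<in> S" for \<sigma>
      using \<open>\<forall>U\<in>\<U>. realization_open S U\<close> that
      by (intro openin_Union) (auto simp: realization_open_def)
    ultimately show ?thesis
      using that unfolding realization_open_def by (metis Union_least)
  qed
  ultimately show ?thesis
    unfolding istopology_def by blast
qed

lemma openin_realization: "openin (realization S) U \<longleftrightarrow> realization_open S U"
  by (simp add: realization_def istopology_realization_open topology_inverse')

lemma topspace_realization: "topspace (realization S) = (\<Union>\<sigma>\<in>S. closed_simplex \<sigma>)"
proof -
  have "(\<Union>\<sigma>\<in>S. closed_simplex \<sigma>) \<inter> closed_simplex \<sigma> =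
      topspace (subtopology (powertop_real UNIV) (closed_simplex \<sigma>))" if "\<sigma> \<in> S" for \<sigma>
    using that by auto
  then have "realization_open S (\<Union>\<sigma>\<in>S. closed_simplex \<sigma>)"
    unfolding realization_open_def by (metis openin_topspace subset_refl)
  moreover have "U \<subseteq> (\<Union>\<sigma>\<in>S. closed_simplex \<sigma>)" if "realization_open S U" for U
    using that by (simp add: realization_open_def)
  ultimately show ?thesis
    unfolding topspace_def openin_realization by blast
qed

text \<open>
  The map that is affine on each simplex and given by \<open>f\<close> on vertices; the sum is finite at every
  point of a realization.
\<close>

definition realization_map :: "('v \<Rightarrow> 'w) \<Rightarrow> ('v \<Rightarrow> real) \<Rightarrow> 'w \<Rightarrow> real"
  where "realization_map f x = (\<lambda>w. \<Sum>v | x v \<noteq> 0 \<and> f v = w. x v)"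

text \<open>The property asserted of \<open>f\<close> in the definition of \<^const>\<open>homotopy_equivalent_space\<close>.\<close>

definition homotopy_equivalence_map :: "'a topology \<Rightarrow> 'b topology \<Rightarrow> ('a \<Rightarrow> 'b) \<Rightarrow> bool"
  where "homotopy_equivalence_map X Y f \<longleftrightarrow>
    continuous_map X Y f \<and>
    (\<exists>g. continuous_map Y X g \<and>
      homotopic_with (\<lambda>x. True) X X (g \<circ> f) id \<and>
      homotopic_with (\<lambda>x. True) Y Y (f \<circ> g) id)"

lemma homotopy_equivalent_space_iff:
  "X homotopy_equivalent_space Y \<longleftrightarrow> (\<exists>f. homotopy_equivalence_map X Y f)"
  unfolding homotopy_equivalent_space_def homotopy_equivalence_map_def by blast


section \<open>Cuboid complexes and multiway Dowker complexes\<close>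

text \<open>
  Tuples indexed by a set \<open>K\<close> of positions are elements of \<^term>\<open>PiE K I\<close>, so that omitting
  the \<open>k\<close>-th factor amounts to replacing \<open>K\<close> by \<^term>\<open>K - {k}\<close>. The product is over
  \<open>K = {1..m}\<close> in the case of \<open>m\<close> sets.
\<close>

definition cuboid :: "'k set \<Rightarrow> ('k \<Rightarrow> 'a set) \<Rightarrow> ('k \<Rightarrow> 'a) set \<Rightarrow> ('k \<Rightarrow> 'a) set set"
  where "cuboid K I R =
    {\<rho> \<in> nonempty_finite_subsets (PiE K I). PiE K (\<lambda>k. (\<lambda>x. x k) ` \<rho>) \<subseteq> R}"

definition slice ::
    "'k set \<Rightarrow> ('k \<Rightarrow> 'a set) \<Rightarrow> ('k \<Rightarrow> 'a) set \<Rightarrow> 'k \<Rightarrow> 'a \<Rightarrow> ('k \<Rightarrow> 'a) set"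
  where "slice K I R k i = {y \<in> PiE (K - {k}) I. y(k := i) \<in> R}"

definition dowker ::
    "'k set \<Rightarrow> ('k \<Rightarrow> 'a set) \<Rightarrow> ('k \<Rightarrow> 'a) set \<Rightarrow> 'k \<Rightarrow> ('k \<Rightarrow> 'a) set set"
  where "dowker K I R k = (\<Union>i\<in>I k. cuboid (K - {k}) I (slice K I R k i))"

definition omit :: "'k set \<Rightarrow> 'k \<Rightarrow> ('k \<Rightarrow> 'a) \<Rightarrow> 'k \<Rightarrow> 'a"
  where "omit K k x = restrict x (K - {k})"

definition product_map :: "'k set \<Rightarrow> ('k \<Rightarrow> 'a \<Rightarrow> 'b) \<Rightarrow> ('k \<Rightarrow> 'a) \<Rightarrow> 'k \<Rightarrow> 'b"
  where "product_map K f x = (\<lambda>k\<in>K. f k (x k))"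

end

theory Submission
  imports Defs
begin

text \<open>
  Fix a position \<open>k\<close>. A tuple is the same thing as a pair of its projection away from \<open>k\<close> and its
  \<open>k\<close>-th entry, and a box is contained in \<open>R\<close> exactly when its projection is a box contained in the
  slices at all of its \<open>k\<close>-th entries. So the cuboid complex depends only on the family
  of subcomplexes \<open>L i = Cuboid (R_i)\<close> that covers the Dowker complex: a simplex is a set of pairs
  whose first projection lies in \<open>L i\<close> for every \<open>i\<close> in its second projection. Everything is proved
  for such a complex of pairs (\<open>cover_complex\<close>, in which \<open>p\<close> and \<open>q\<close> are the two projections) of an
  arbitrary family \<open>L\<close>.

  The map induced by \<open>p\<close> is a homotopy equivalence because it has an explicit homotopy inverse. Read
  points of a realization as finitely supported probability measures. For a point \<open>x\<close> of
  \<open>\<Union>i. L i\<close>, let \<open>trim x\<close> be \<open>x\<close> cut off below a positive threshold that is smaller than the maximum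
  of \<open>x\<close>, and renormalized. Choose for each simplex \<open>\<tau>\<close> an index \<open>c \<tau>\<close> with \<open>\<tau> \<in> L (c \<tau>)\<close>, and
  let \<open>blend c x\<close> be a mixture of the indices \<open>c \<tau>\<close> over those faces \<open>\<tau>\<close> of the support of \<open>x\<close>
  that contain the support of \<open>trim x\<close>. As each \<open>L i\<close> is closed under faces, the support of \<open>trim x\<close>
  then lies in \<open>L i\<close> for every index \<open>i\<close> that occurs, so the product measure
  \<open>g x = trim x \<times> blend c x\<close> is a point of the complex of pairs. Trimming is what makes this work:
  the full support of \<open>x\<close> need not lie in \<open>L (c \<tau>)\<close> when \<open>\<tau>\<close> is a proper face.

  The first marginal of \<open>g x\<close> is \<open>trim x\<close>, which a straight line joins to \<open>x\<close> within the simplex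
  supporting \<open>x\<close>. Conversely, let \<open>z\<close> be a point of the complex of pairs with marginals \<open>x\<close> and \<open>y\<close>.
  A straight line joins \<open>z\<close> to \<open>trim x \<times> y\<close> within the box spanned by the support of \<open>z\<close>, and a second
  one joins that to \<open>trim x \<times> blend c x\<close>, since the support of \<open>trim x\<close> lies in \<open>L i\<close> for all indices
  \<open>i\<close> in the supports of \<open>y\<close> and of \<open>blend c x\<close>. That straight lines give homotopies in the
  weak topology is \<open>homotopic_straight_line\<close>; it rests on the fact that the product of the realization with
  the interval again carries the weak topology.
\<close>

section \<open>Points of a realization\<close>

definition supp :: "('v \<Rightarrow> real) \<Rightarrow> 'v set"
  where "supp x = {v. x v \<noteq> 0}"

text \<open>
  The sum over an infinite set is \<open>0\<close> by convention, so the closed simplex on an infinite set is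
  empty.
\<close>

lemma closed_simplex_finite:
  assumes "x \<in> closed_simplex \<sigma>"
  shows "finite \<sigma>"
proof (rule ccontr)
  assume "infinite \<sigma>"
  then have "sum x \<sigma> = 0" by simp
  then show False using assms by (simp add: closed_simplex_def)
qed

lemma closed_simplex_nonneg: "x \<in> closed_simplex \<sigma> \<Longrightarrow> 0 \<le> x v"
  by (simp add: closed_simplex_def)

lemma supp_closed_simplex: "x \<in> closed_simplex \<sigma> \<Longrightarrow> supp x \<subseteq> \<sigma>"
  by (auto simp: closed_simplex_def supp_def)

lemma finite_supp: "x \<in> closed_simplex \<sigma> \<Longrightarrow> finite (supp x)"
  by (meson closed_simplex_finite finite_subset supp_closed_simplex)

lemma supp_nonempty:
  assumes "x \<in> closed_simplex \<sigma>"
  shows "supp x \<noteq> {}"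
proof
  assume "supp x = {}"
  then have "sum x \<sigma> = 0" by (simp add: supp_def)
  then show False using assms by (simp add: closed_simplex_def)
qed

lemma sum_supp:
  assumes "x \<in> closed_simplex \<sigma>" "\<And>v. x v = 0 \<Longrightarrow> f v = 0"
  shows "sum f (supp x) = sum f \<sigma>"
  using assms supp_closed_simplex[OF assms(1)] closed_simplex_finite[OF assms(1)]
  by (intro sum.mono_neutral_left) (auto simp: supp_def)

lemma closed_simplexI:
  assumes "\<And>v. 0 \<le> x v" "supp x \<subseteq> \<sigma>" "sum x \<sigma> = 1"
  shows "x \<in> closed_simplex \<sigma>"
  using assms by (auto simp: closed_simplex_def supp_def)

lemma closed_simplex_supp:
  assumes "x \<in> closed_simplex \<sigma>"
  shows "x \<in> closed_simplex (supp x)"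
  using assms sum_supp[OF assms, of x] by (auto simp: closed_simplex_def supp_def)

lemma closed_simplex_mono:
  assumes "x \<in> closed_simplex \<sigma>" "\<sigma> \<subseteq> \<tau>" "finite \<tau>"
  shows "x \<in> closed_simplex \<tau>"
proof -
  have "sum x \<sigma> = sum x \<tau>"
    using assms by (intro sum.mono_neutral_left) (auto simp: closed_simplex_def)
  then show ?thesis using assms by (auto simp: closed_simplex_def)
qed

text \<open>
  Each point lies in the interior of exactly one simplex, the one spanned by its support. This makes
  supports the right tool for deciding where a point lies.
\<close>

lemma topspace_realization_iff:
  assumes "abstract_complex_on V S"
  shows "x \<in> topspace (realization S) \<longleftrightarrow> supp x \<in> S \<and> x \<in> closed_simplex (supp x)"
proof
  assume "x \<in> topspace (realization S)"
  then obtain \<sigma> where \<sigma>: "\<sigma> \<in> S" "x \<in> closed_simplex \<sigma>"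
    by (auto simp: topspace_realization)
  then have "supp x \<in> nonempty_finite_subsets V"
    using assms supp_closed_simplex[of x \<sigma>] finite_supp[of x \<sigma>] supp_nonempty[of x \<sigma>]
    unfolding abstract_complex_on_def nonempty_finite_subsets_def by blast
  then have "supp x \<in> S"
    using assms \<sigma> supp_closed_simplex[of x \<sigma>] unfolding abstract_complex_on_def by blast
  then show "supp x \<in> S \<and> x \<in> closed_simplex (supp x)"
    using closed_simplex_supp \<sigma> by blast
qed (auto simp: topspace_realization)

lemma closed_closed_simplex: "closed (closed_simplex \<sigma>)"
proof -
  have "closed_simplex \<sigma> = {x. \<forall>v. 0 \<le> x v} \<inter> {x. \<forall>v. v \<notin> \<sigma> \<longrightarrow> x v = 0} \<inter> {x. sum x \<sigma> = 1}"
    by (auto simp: closed_simplex_def)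
  moreover have "closed {x::'a \<Rightarrow> real. \<forall>v. 0 \<le> x v}"
    by (intro closed_Collect_all closed_Collect_le continuous_intros continuous_on_product_coordinates)
  moreover have "closed {x::'a \<Rightarrow> real. \<forall>v. v \<notin> \<sigma> \<longrightarrow> x v = 0}"
    by (intro closed_Collect_all closed_Collect_imp closed_Collect_eq continuous_intros
        continuous_on_product_coordinates) auto
  moreover have "closed {x::'a \<Rightarrow> real. sum x \<sigma> = 1}"
    by (intro closed_Collect_eq continuous_intros continuous_on_product_coordinates)
  ultimately show ?thesis by auto
qed

section \<open>Continuity for the weak topology\<close>

lemma openin_realization_iff:
  "openin (realization S) U \<longleftrightarrow> U \<subseteq> topspace (realization S) \<and>
    (\<forall>\<sigma>\<in>S. openin (top_of_set (closed_simplex \<sigma>)) (U \<inter> closed_simplex \<sigma>))"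
  by (simp add: openin_realization realization_open_def topspace_realization euclidean_product_topology)

lemma closedin_realization_simplex:
  assumes "closedin (realization S) C" "\<sigma> \<in> S"
  shows "closed (C \<inter> closed_simplex \<sigma>)"
proof -
  have *: "openin (realization S) (topspace (realization S) - C)" "C \<subseteq> topspace (realization S)"
    using assms by (auto simp: closedin_def)
  have "C \<inter> closed_simplex \<sigma> =
      closed_simplex \<sigma> - (topspace (realization S) - C) \<inter> closed_simplex \<sigma>"
    using assms(2) by (auto simp: topspace_realization)
  moreover have "openin (top_of_set (closed_simplex \<sigma>))
      ((topspace (realization S) - C) \<inter> closed_simplex \<sigma>)"
    using *(1) assms(2) by (simp add: openin_realization_iff)
  ultimately have "closedin (top_of_set (closed_simplex \<sigma>)) (C \<inter> closed_simplex \<sigma>)"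
    by (simp add: closedin_diff)
  then show ?thesis
    using closed_closed_simplex closedin_closed_trans by blast
qed

text \<open>
  A map that meets only finitely many simplices is continuous for the weak topology as soon as its
  coordinates are continuous: the preimage of a closed set is the union of the preimages of its
  traces on these simplices, and each trace is closed in the product topology.
\<close>

lemma continuous_map_into_realization:
  assumes S: "abstract_complex_on V S" and F: "finite F"
    and h: "continuous_map X euclidean h"
    and into: "\<And>t. t \<in> topspace X \<Longrightarrow> h t \<in> topspace (realization S) \<and> supp (h t) \<subseteq> F"
  shows "continuous_map X (realization S) h"
  unfolding continuous_map_closedin
proof (intro conjI allI impI)
  show "h \<in> topspace X \<rightarrow> topspace (realization S)"
    by (rule Pi_I) (simp add: into)
next
  fix C assume C: "closedin (realization S) C"
  have "\<exists>\<sigma>\<in>S \<inter> Pow F. h t \<in> closed_simplex \<sigma>" if "t \<in> topspace X" for t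
  proof
    show "h t \<in> closed_simplex (supp (h t))" "supp (h t) \<in> S \<inter> Pow F"
      using into[OF that] topspace_realization_iff[OF S, of "h t"] by simp_all
  qed
  then have "{t \<in> topspace X. h t \<in> C} =
      (\<Union>\<sigma>\<in>S \<inter> Pow F. {t \<in> topspace X. h t \<in> C \<inter> closed_simplex \<sigma>})" (is "_ = ?U")
    by fast
  moreover have "closedin X {t \<in> topspace X. h t \<in> C \<inter> closed_simplex \<sigma>}" if "\<sigma> \<in> S" for \<sigma>
  proof (rule closedin_continuous_map_preimage[OF h])
    show "closedin euclidean (C \<inter> closed_simplex \<sigma>)"
      using closedin_realization_simplex[OF C that] by (simp only: closed_closedin)
  qed
  then have "closedin X ?U"
    using F by (intro closedin_Union finite_imageI) auto
  ultimately show "closedin X {t \<in> topspace X. h t \<in> C}"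
    by simp
qed

lemma continuous_map_from_realization:
  assumes "\<And>\<sigma>. \<sigma> \<in> S \<Longrightarrow> continuous_map (top_of_set (closed_simplex \<sigma>)) Z f"
  shows "continuous_map (realization S) Z f"
  unfolding continuous_map_def
proof (intro conjI allI impI)
  show "f \<in> topspace (realization S) \<rightarrow> topspace Z"
    using assms by (fastforce simp: topspace_realization continuous_map_def)
next
  fix U assume U: "openin Z U"
  have "{x \<in> topspace (realization S). f x \<in> U} \<inter> closed_simplex \<sigma> =
      {x \<in> topspace (top_of_set (closed_simplex \<sigma>)). f x \<in> U}" if "\<sigma> \<in> S" for \<sigma>
    using that by (auto simp: topspace_realization)
  then show "openin (realization S) {x \<in> topspace (realization S). f x \<in> U}"
    using openin_continuous_map_preimage[OF assms U] unfolding openin_realization_iff by auto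
qed

text \<open>
  The product with the interval again has the weak topology, by compactness of closed
  subintervals. Given a point \<open>(t, z)\<close> of the preimage of an open set, choose a compact
  neighbourhood \<open>N\<close> of \<open>t\<close> with \<open>N \<times> {z}\<close> in the preimage. The set of all \<open>y\<close> with
  \<open>N \<times> {y}\<close> in the preimage is open in every simplex, by the tube lemma, and hence open.
\<close>

lemma continuous_map_from_interval_times_realization:
  assumes H: "\<And>\<sigma>. \<sigma> \<in> S \<Longrightarrow>
      continuous_map (prod_topology (top_of_set {0..1::real}) (top_of_set (closed_simplex \<sigma>))) Z H"
  shows "continuous_map (prod_topology (top_of_set {0..1}) (realization S)) Z H"
  unfolding continuous_map_def
proof (intro conjI allI impI)
  show "H \<in> topspace (prod_topology (top_of_set {0..1}) (realization S)) \<rightarrow> topspace Z"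
    using H by (fastforce simp: topspace_realization continuous_map_def)
next
  fix U assume U: "openin Z U"
  let ?W = "{p \<in> topspace (prod_topology (top_of_set {0..1}) (realization S)). H p \<in> U}"
  have "\<exists>A B. openin (top_of_set {0..1}) A \<and> openin (realization S) B \<and> t \<in> A \<and> z \<in> B \<and> A \<times> B \<subseteq> ?W"
    if tz: "(t, z) \<in> ?W" for t z
  proof -
    have t: "t \<in> {0..1}" and z: "z \<in> topspace (realization S)" and HU: "H (t, z) \<in> U"
      using tz by auto
    obtain \<sigma>0 where \<sigma>0: "\<sigma>0 \<in> S" "z \<in> closed_simplex \<sigma>0"
      using z by (auto simp: topspace_realization)
    have "continuous_map (top_of_set {0..1}) Z (H \<circ> (\<lambda>s. (s, z)))"
      by (rule continuous_map_compose[OF _ H[OF \<sigma>0(1)]])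
        (use \<sigma>0 in \<open>auto intro!: continuous_on_Pair continuous_on_const continuous_on_id\<close>)
    then have "openin (top_of_set {0..1}) {s \<in> {0..1}. H (s, z) \<in> U}"
      using openin_continuous_map_preimage[OF _ U] by fastforce
    then obtain e where e: "e > 0" "cball t e \<inter> {0..1} \<subseteq> {s \<in> {0..1}. H (s, z) \<in> U}"
      using t HU unfolding openin_contains_cball by blast
    define N where "N = cball t e \<inter> {0..1}"
    have N: "compact N" "N \<subseteq> {0..1}"
      by (auto simp: N_def)
    define B where "B = {y \<in> topspace (realization S). \<forall>s\<in>N. H (s, y) \<in> U}"
    \<comment> \<open>The complement of \<open>B\<close> in the simplex is the image of a closed set under the projection
    along the compact set \<open>N\<close>, which is a closed map.\<close>
    have "openin (top_of_set (closed_simplex \<sigma>)) (B \<inter> closed_simplex \<sigma>)" if "\<sigma> \<in> S" for \<sigma>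
    proof -
      let ?P = "prod_topology (top_of_set N) (top_of_set (closed_simplex \<sigma>))"
      have "continuous_map ?P Z H"
        using continuous_map_from_subtopology[OF H[OF that], of "N \<times> closed_simplex \<sigma>"] N(2)
        by (simp add: subtopology_Times subtopology_subtopology Times_Int_Times inf.absorb2)
      then have "openin ?P {p \<in> topspace ?P. H p \<in> U}"
        by (rule openin_continuous_map_preimage[OF _ U])
      then have "closedin ?P (topspace ?P - {p \<in> topspace ?P. H p \<in> U})"
        by (rule closedin_diff[OF closedin_topspace])
      moreover have "closed_map ?P (top_of_set (closed_simplex \<sigma>)) snd"
        using N(1) by (intro closed_map_snd) (simp add: compact_space_subtopology)
      ultimately have "closedin (top_of_set (closed_simplex \<sigma>))
          (snd ` (topspace ?P - {p \<in> topspace ?P. H p \<in> U}))"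
        by (auto simp: closed_map_def)
      moreover have "B \<inter> closed_simplex \<sigma> =
          closed_simplex \<sigma> - snd ` (topspace ?P - {p \<in> topspace ?P. H p \<in> U})"
      proof -
        have "snd ` (topspace ?P - {p \<in> topspace ?P. H p \<in> U}) =
            {y \<in> closed_simplex \<sigma>. \<exists>s\<in>N. H (s, y) \<notin> U}"
          by force
        then show ?thesis
          using that by (auto simp: B_def topspace_realization)
      qed
      ultimately show ?thesis
        using openin_diff[OF openin_subtopology_self] by simp
    qed
    then have "openin (realization S) B"
      unfolding openin_realization_iff by (auto simp: B_def)
    moreover have "openin (top_of_set {0..1}) (ball t e \<inter> {0..1})"
      by (subst Int_commute) (intro openin_open_Int open_ball)
    moreover have "z \<in> B" using e z by (auto simp: B_def N_def)
    moreover have "(ball t e \<inter> {0..1}) \<times> B \<subseteq> ?W"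
      by (auto simp: B_def N_def)
    ultimately show ?thesis using t e(1)
      by (intro exI[of _ "ball t e \<inter> {0..1}"] exI[of _ B]) auto
  qed
  then show "openin (prod_topology (top_of_set {0..1}) (realization S)) ?W"
    unfolding openin_prod_topology_alt by blast
qed

text \<open>
  All maps below are given by explicit formulas on each simplex. The common finite bound on the
  supports ensures that the image of a simplex meets only finitely many simplices.
\<close>

definition simplexwise_continuous :: "'v set set \<Rightarrow> (('v \<Rightarrow> real) \<Rightarrow> 'w \<Rightarrow> real) \<Rightarrow> bool"
  where "simplexwise_continuous S f \<longleftrightarrow> (\<forall>\<sigma>\<in>S. continuous_on (closed_simplex \<sigma>) f \<and>
    (\<exists>F. finite F \<and> (\<forall>x\<in>closed_simplex \<sigma>. supp (f x) \<subseteq> F)))"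

lemma continuous_map_simplexwise:
  assumes "abstract_complex_on W T" "simplexwise_continuous S f"
    and "f \<in> topspace (realization S) \<rightarrow> topspace (realization T)"
  shows "continuous_map (realization S) (realization T) f"
proof (rule continuous_map_from_realization)
  fix \<sigma> assume \<sigma>: "\<sigma> \<in> S"
  then obtain F where F: "finite F" "\<forall>x\<in>closed_simplex \<sigma>. supp (f x) \<subseteq> F"
    and c: "continuous_on (closed_simplex \<sigma>) f"
    using assms(2) unfolding simplexwise_continuous_def by blast
  show "continuous_map (top_of_set (closed_simplex \<sigma>)) (realization T) f"
    using \<sigma> F c assms(3)
    by (intro continuous_map_into_realization[OF assms(1) F(1)]) (auto simp: topspace_realization)
qed

text \<open>
  The analogue of contiguous simplicial maps: if \<open>f x\<close> and \<open>g x\<close> always lie in a common simplex,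
  then so does the segment between them.
\<close>

lemma homotopic_straight_line:
  assumes T: "abstract_complex_on W T"
    and f: "simplexwise_continuous S f" and g: "simplexwise_continuous S g"
    and fT: "f \<in> topspace (realization S) \<rightarrow> topspace (realization T)"
    and gT: "g \<in> topspace (realization S) \<rightarrow> topspace (realization T)"
    and fg: "\<And>x. x \<in> topspace (realization S) \<Longrightarrow> supp (f x) \<union> supp (g x) \<in> T"
  shows "homotopic_with (\<lambda>x. True) (realization S) (realization T) f g"
proof -
  define H where "H = (\<lambda>(t, x) w. (1 - t) * f x w + t * g x w)"
  have HT: "H (t, x) \<in> topspace (realization T)" if t: "t \<in> {0..1}" and x: "x \<in> topspace (realization S)"
    for t x
  proof -
    let ?\<tau> = "supp (f x) \<union> supp (g x)"
    have "finite ?\<tau>"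
      using fg[OF x] T by (auto simp: abstract_complex_on_def nonempty_finite_subsets_def)
    then have *: "f x \<in> closed_simplex ?\<tau>" "g x \<in> closed_simplex ?\<tau>"
      using fT gT x topspace_realization_iff[OF T]
      by (blast intro: closed_simplex_mono)+
    have "sum (H (t, x)) ?\<tau> = (1 - t) * sum (f x) ?\<tau> + t * sum (g x) ?\<tau>"
      by (simp add: H_def sum.distrib sum_distrib_left)
    also have "\<dots> = 1" using * by (simp add: closed_simplex_def)
    finally have "H (t, x) \<in> closed_simplex ?\<tau>"
      using * t by (intro closed_simplexI) (auto simp: H_def supp_def closed_simplex_nonneg)
    then show ?thesis using fg[OF x] by (auto simp: topspace_realization)
  qed
  have "continuous_map (prod_topology (top_of_set {0..1}) (realization S)) (realization T) H"
  proof (rule continuous_map_from_interval_times_realization)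
    fix \<sigma> assume \<sigma>: "\<sigma> \<in> S"
    obtain F where F: "finite F" "\<forall>x\<in>closed_simplex \<sigma>. supp (f x) \<subseteq> F"
      and cf: "continuous_on (closed_simplex \<sigma>) f"
      using f \<sigma> unfolding simplexwise_continuous_def by blast
    obtain G where G: "finite G" "\<forall>x\<in>closed_simplex \<sigma>. supp (g x) \<subseteq> G"
      and cg: "continuous_on (closed_simplex \<sigma>) g"
      using g \<sigma> unfolding simplexwise_continuous_def by blast
    have "continuous_on ({0..1} \<times> closed_simplex \<sigma>) (\<lambda>p. f (snd p))"
         "continuous_on ({0..1} \<times> closed_simplex \<sigma>) (\<lambda>p. g (snd p))"
      by (auto intro!: continuous_on_compose2[OF cf] continuous_on_compose2[OF cg]
          continuous_on_snd continuous_on_id)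
    then have "continuous_on ({0..1} \<times> closed_simplex \<sigma>) (\<lambda>p. f (snd p) w)"
         "continuous_on ({0..1} \<times> closed_simplex \<sigma>) (\<lambda>p. g (snd p) w)" for w
      by - (erule continuous_on_product_then_coordinatewise)+
    then have "continuous_on ({0..1} \<times> closed_simplex \<sigma>) H"
      unfolding H_def case_prod_beta
      by (intro continuous_on_coordinatewise_then_product continuous_intros)
    then have "continuous_map (prod_topology (top_of_set {0..1}) (top_of_set (closed_simplex \<sigma>))) euclidean H"
      by (simp add: prod_topology_subtopology_eu)
    then show "continuous_map (prod_topology (top_of_set {0..1}) (top_of_set (closed_simplex \<sigma>)))
        (realization T) H"
    proof (rule continuous_map_into_realization[OF T finite_UnI[OF F(1) G(1)]])
      fix p assume p: "p \<in> topspace (prod_topology (top_of_set {0..1::real}) (top_of_set (closed_simplex \<sigma>)))"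
      then have "snd p \<in> closed_simplex \<sigma>" by auto
      then have "supp (f (snd p)) \<union> supp (g (snd p)) \<subseteq> F \<union> G" using F G by blast
      moreover have "supp (H p) \<subseteq> supp (f (snd p)) \<union> supp (g (snd p))"
        by (auto simp: H_def supp_def case_prod_beta)
      moreover have "fst p \<in> {0..1}" "snd p \<in> topspace (realization S)"
        using p \<sigma> by (auto simp: topspace_realization)
      then have "H p \<in> topspace (realization T)"
        using HT[of "fst p" "snd p"] by simp
      ultimately show "H p \<in> topspace (realization T) \<and> supp (H p) \<subseteq> F \<union> G"
        by blast
    qed
  qed
  then show ?thesis
    unfolding homotopic_with_def by (intro exI[of _ H]) (auto simp: H_def)
qed

section \<open>Trimming a point and blending indices\<close>

text \<open>
  Half the square sum of the coordinates is a positive quantity, polynomial on each simplex, that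
  stays below the maximal coordinate: for coordinates summing to \<open>1\<close>, the square sum is at most the
  maximum.
\<close>

definition threshold :: "('v \<Rightarrow> real) \<Rightarrow> real"
  where "threshold x = (\<Sum>v\<in>supp x. (x v)\<^sup>2) / 2"

definition trim :: "('v \<Rightarrow> real) \<Rightarrow> 'v \<Rightarrow> real"
  where "trim x v = max 0 (x v - threshold x) / (\<Sum>u\<in>supp x. max 0 (x u - threshold x))"

text \<open>
  The weight is positive precisely if \<open>\<tau>\<close> consists of coordinates that are positive and contains
  all those that reach the threshold. The second product runs over the support only, but
  coordinates that vanish would contribute the factor \<open>1\<close>; this is why the weight is continuous on
  closed simplices, where the support jumps.
\<close>

definition cut_weight :: "('v \<Rightarrow> real) \<Rightarrow> 'v set \<Rightarrow> real"
  where "cut_weight x \<tau> = (\<Prod>v\<in>\<tau>. x v) * (\<Prod>v\<in>supp x - \<tau>. max 0 (1 - x v / threshold x))"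

text \<open>
  The probability measure on indices obtained by pushing the normalized cut weights forward
  along \<open>c\<close>.
\<close>

definition blend :: "('v set \<Rightarrow> 'y) \<Rightarrow> ('v \<Rightarrow> real) \<Rightarrow> 'y \<Rightarrow> real"
  where "blend c x i = (\<Sum>\<tau> | \<tau> \<subseteq> supp x \<and> c \<tau> = i. cut_weight x \<tau>) /
    (\<Sum>\<tau>\<in>Pow (supp x). cut_weight x \<tau>)"

lemma threshold_eq:
  assumes "x \<in> closed_simplex \<sigma>"
  shows "threshold x = (\<Sum>v\<in>\<sigma>. (x v)\<^sup>2) / 2"
  using sum_supp[OF assms, of "\<lambda>v. (x v)\<^sup>2"] by (simp add: threshold_def)

lemma threshold_pos:
  assumes "x \<in> closed_simplex \<sigma>"
  shows "threshold x > 0"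
proof -
  have "(\<Sum>v\<in>supp x. (x v)\<^sup>2) > 0"
    using finite_supp[OF assms] supp_nonempty[OF assms]
    by (intro sum_pos) (auto simp: supp_def)
  then show ?thesis by (simp add: threshold_def)
qed

text \<open>
  Otherwise the square sum would be at most \<open>threshold x\<close> times the sum of the coordinates, that is,
  at most half of itself.
\<close>

lemma exceeds_threshold:
  assumes x: "x \<in> closed_simplex \<sigma>"
  shows "\<exists>v\<in>supp x. x v > threshold x"
proof (rule ccontr)
  assume "\<not> ?thesis"
  then have le: "x v \<le> threshold x" if "v \<in> supp x" for v
    using that by force
  have "(\<Sum>v\<in>supp x. (x v)\<^sup>2) \<le> (\<Sum>v\<in>supp x. threshold x * x v)"
    using le closed_simplex_nonneg[OF x]
    by (intro sum_mono) (simp add: power2_eq_square mult_right_mono)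
  also have "\<dots> = threshold x * sum x (supp x)"
    by (simp add: sum_distrib_left)
  also have "\<dots> = threshold x"
    using closed_simplex_supp[OF x] by (simp add: closed_simplex_def)
  finally show False
    using threshold_pos[OF x] by (simp add: threshold_def)
qed

lemma trim_sum_pos:
  assumes x: "x \<in> closed_simplex \<sigma>"
  shows "(\<Sum>u\<in>supp x. max 0 (x u - threshold x)) > 0"
proof -
  obtain v where "v \<in> supp x" "x v > threshold x"
    using exceeds_threshold[OF x] by blast
  then show ?thesis
    using finite_supp[OF x] by (intro sum_pos2[of _ v]) auto
qed

lemma supp_trim:
  assumes x: "x \<in> closed_simplex \<sigma>"
  shows "supp (trim x) = {v. x v > threshold x}"
  using trim_sum_pos[OF x] by (auto simp: supp_def trim_def max_def)

lemma supp_trim_subset: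
  assumes x: "x \<in> closed_simplex \<sigma>"
  shows "supp (trim x) \<subseteq> supp x"
  using threshold_pos[OF x] unfolding supp_trim[OF x] by (auto simp: supp_def)

lemma trim_closed_simplex:
  assumes x: "x \<in> closed_simplex \<sigma>"
  shows "trim x \<in> closed_simplex (supp x)"
proof (rule closed_simplexI)
  show "sum (trim x) (supp x) = 1"
    using trim_sum_pos[OF x] by (simp add: trim_def flip: sum_divide_distrib)
qed (use trim_sum_pos[OF x] supp_trim_subset[OF x] in \<open>auto simp: trim_def\<close>)

lemma trim_eq:
  assumes x: "x \<in> closed_simplex \<sigma>"
  shows "trim x v = max 0 (x v - threshold x) / (\<Sum>u\<in>\<sigma>. max 0 (x u - threshold x))"
proof -
  have "(\<Sum>u\<in>supp x. max 0 (x u - threshold x)) = (\<Sum>u\<in>\<sigma>. max 0 (x u - threshold x))"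
    using threshold_pos[OF x] by (intro sum_supp[OF x]) simp
  then show ?thesis by (simp add: trim_def)
qed

lemma continuous_on_coordinate: "continuous_on A (\<lambda>x::'v \<Rightarrow> real. x v)"
  by (rule continuous_on_product_then_coordinatewise[OF continuous_on_id])

lemma continuous_on_threshold: "continuous_on (closed_simplex \<sigma>) threshold"
proof -
  have "continuous_on (closed_simplex \<sigma>) (\<lambda>x. (\<Sum>v\<in>\<sigma>. (x v)\<^sup>2) / 2)"
    by (intro continuous_intros continuous_on_coordinate) auto
  then show ?thesis
    by (rule continuous_on_eq) (simp add: threshold_eq)
qed

lemma continuous_on_trim: "continuous_on (closed_simplex \<sigma>) trim"
proof (rule continuous_on_coordinatewise_then_product)
  fix v
  have "(\<Sum>u\<in>\<sigma>. max 0 (x u - threshold x)) \<noteq> 0" if x: "x \<in> closed_simplex \<sigma>" for x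
    using trim_sum_pos[OF x] sum_supp[OF x, of "\<lambda>u. max 0 (x u - threshold x)"] threshold_pos[OF x]
    by simp
  then have "continuous_on (closed_simplex \<sigma>)
      (\<lambda>x. max 0 (x v - threshold x) / (\<Sum>u\<in>\<sigma>. max 0 (x u - threshold x)))"
    by (intro continuous_intros continuous_on_coordinate continuous_on_threshold) auto
  then show "continuous_on (closed_simplex \<sigma>) (\<lambda>x. trim x v)"
    by (rule continuous_on_eq) (simp add: trim_eq)
qed

lemma cut_weight_nonneg:
  assumes "x \<in> closed_simplex \<sigma>"
  shows "cut_weight x \<tau> \<ge> 0"
  using closed_simplex_nonneg[OF assms] by (simp add: cut_weight_def prod_nonneg)

lemma cut_weight_eq:
  assumes x: "x \<in> closed_simplex \<sigma>"
  shows "cut_weight x \<tau> = (\<Prod>v\<in>\<tau>. x v) * (\<Prod>v\<in>\<sigma> - \<tau>. max 0 (1 - x v / threshold x))"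
proof -
  have "(\<Prod>v\<in>supp x - \<tau>. max 0 (1 - x v / threshold x)) =
      (\<Prod>v\<in>\<sigma> - \<tau>. max 0 (1 - x v / threshold x))"
    using supp_closed_simplex[OF x] closed_simplex_finite[OF x]
    by (intro prod.mono_neutral_left) (auto simp: supp_def)
  then show ?thesis by (simp add: cut_weight_def)
qed

lemma cut_weight_outside:
  assumes "x v = 0" "v \<in> \<tau>" "finite \<tau>"
  shows "cut_weight x \<tau> = 0"
  using assms by (auto simp: cut_weight_def)

text \<open>
  A coordinate above the threshold that is not in \<open>\<tau>\<close> gives a vanishing factor of the weight.
\<close>

lemma supp_trim_subset_cut:
  assumes x: "x \<in> closed_simplex \<sigma>" and w: "cut_weight x \<tau> \<noteq> 0"
  shows "supp (trim x) \<subseteq> \<tau>"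
proof
  fix v assume v: "v \<in> supp (trim x)"
  then have "x v > threshold x" using supp_trim[OF x] by auto
  then have "max 0 (1 - x v / threshold x) = 0"
    using threshold_pos[OF x] by (simp add: field_simps)
  moreover have "\<forall>u\<in>supp x - \<tau>. max 0 (1 - x u / threshold x) \<noteq> 0"
    using w finite_supp[OF x] by (auto simp: cut_weight_def)
  ultimately show "v \<in> \<tau>"
    using v supp_trim_subset[OF x] by blast
qed

text \<open>
  The set of coordinates that reach the threshold has positive weight.
\<close>

lemma cut_weight_sum_pos:
  assumes x: "x \<in> closed_simplex \<sigma>"
  shows "(\<Sum>\<tau>\<in>Pow (supp x). cut_weight x \<tau>) > 0"
proof (rule sum_pos2)
  define \<tau> where "\<tau> = {v \<in> supp x. x v \<ge> threshold x}"
  show "\<tau> \<in> Pow (supp x)" by (auto simp: \<tau>_def)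
  have "(\<Prod>v\<in>\<tau>. x v) > 0"
    using threshold_pos[OF x] by (intro prod_pos) (auto simp: \<tau>_def)
  moreover have "(\<Prod>v\<in>supp x - \<tau>. max 0 (1 - x v / threshold x)) > 0"
    using threshold_pos[OF x] by (intro prod_pos) (auto simp: \<tau>_def less_max_iff_disj)
  ultimately show "cut_weight x \<tau> > 0" by (simp add: cut_weight_def)
qed (use finite_supp[OF x] cut_weight_nonneg[OF x] in auto)

lemma blend_nonneg:
  assumes x: "x \<in> closed_simplex \<sigma>"
  shows "blend c x i \<ge> 0"
  using cut_weight_nonneg[OF x] by (simp add: blend_def sum_nonneg)

text \<open>
  The property that places \<open>trim x\<close> and every index in the blend in one common subcomplex.
\<close>

lemma supp_blend:
  assumes x: "x \<in> closed_simplex \<sigma>" and i: "i \<in> supp (blend c x)"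
  shows "\<exists>\<tau>. \<tau> \<subseteq> supp x \<and> supp (trim x) \<subseteq> \<tau> \<and> c \<tau> = i"
proof -
  have "(\<Sum>\<tau> | \<tau> \<subseteq> supp x \<and> c \<tau> = i. cut_weight x \<tau>) \<noteq> 0"
    using i by (auto simp: supp_def blend_def)
  then obtain \<tau> where \<tau>: "\<tau> \<in> {\<tau>. \<tau> \<subseteq> supp x \<and> c \<tau> = i}" "cut_weight x \<tau> \<noteq> 0"
    by (rule sum.not_neutral_contains_not_neutral)
  then show ?thesis using supp_trim_subset_cut[OF x \<tau>(2)] by blast
qed

lemma blend_closed_simplex:
  assumes x: "x \<in> closed_simplex \<sigma>"
  shows "blend c x \<in> closed_simplex (c ` Pow (supp x))"
proof (rule closed_simplexI)
  let ?W = "\<Sum>\<tau>\<in>Pow (supp x). cut_weight x \<tau>"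
  have "sum (blend c x) (c ` Pow (supp x)) =
      (\<Sum>i\<in>c ` Pow (supp x). \<Sum>\<tau>\<in>{\<tau> \<in> Pow (supp x). c \<tau> = i}. cut_weight x \<tau>) / ?W"
    unfolding blend_def sum_divide_distrib[of _ _ ?W] Pow_iff ..
  also have "(\<Sum>i\<in>c ` Pow (supp x). \<Sum>\<tau>\<in>{\<tau> \<in> Pow (supp x). c \<tau> = i}. cut_weight x \<tau>) = ?W"
    using finite_supp[OF x] by (intro sum.image_gen[symmetric]) simp
  finally show "sum (blend c x) (c ` Pow (supp x)) = 1"
    using cut_weight_sum_pos[OF x] by simp
next
  show "supp (blend c x) \<subseteq> c ` Pow (supp x)"
    using supp_blend[OF x, of _ c] by (intro subsetI) (metis PowI image_eqI)
qed (rule blend_nonneg[OF x])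

text \<open>
  On the closed simplex on \<open>\<sigma>\<close>, all sums may be taken over the faces of \<open>\<sigma>\<close>, independently of the
  support of the point: a face outside the support has a vanishing coordinate and thus weight \<open>0\<close>.
\<close>

lemma continuous_on_blend:
  assumes \<sigma>: "finite \<sigma>"
  shows "continuous_on (closed_simplex \<sigma>) (blend c)"
proof (rule continuous_on_coordinatewise_then_product)
  fix i
  let ?w = "\<lambda>\<tau> x. (\<Prod>v\<in>\<tau>. x v) * (\<Prod>v\<in>\<sigma> - \<tau>. max 0 (1 - x v / threshold x))"
  have eq: "(\<Sum>\<tau> | \<tau> \<subseteq> supp x \<and> P \<tau>. cut_weight x \<tau>) = (\<Sum>\<tau> | \<tau> \<subseteq> \<sigma> \<and> P \<tau>. ?w \<tau> x)"
    if x: "x \<in> closed_simplex \<sigma>" for x P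
  proof -
    have "(\<Sum>\<tau> | \<tau> \<subseteq> supp x \<and> P \<tau>. cut_weight x \<tau>) = (\<Sum>\<tau> | \<tau> \<subseteq> \<sigma> \<and> P \<tau>. cut_weight x \<tau>)"
    proof (rule sum.mono_neutral_left)
      show "finite {\<tau>. \<tau> \<subseteq> \<sigma> \<and> P \<tau>}" using \<sigma> by simp
      show "{\<tau>. \<tau> \<subseteq> supp x \<and> P \<tau>} \<subseteq> {\<tau>. \<tau> \<subseteq> \<sigma> \<and> P \<tau>}"
        using supp_closed_simplex[OF x] by blast
      show "\<forall>\<tau>\<in>{\<tau>. \<tau> \<subseteq> \<sigma> \<and> P \<tau>} - {\<tau>. \<tau> \<subseteq> supp x \<and> P \<tau>}. cut_weight x \<tau> = 0"
      proof
        fix \<tau> assume *: "\<tau> \<in> {\<tau>. \<tau> \<subseteq> \<sigma> \<and> P \<tau>} - {\<tau>. \<tau> \<subseteq> supp x \<and> P \<tau>}"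
        then obtain v where "v \<in> \<tau>" "x v = 0" by (auto simp: supp_def)
        moreover have "finite \<tau>" using * \<sigma> finite_subset by blast
        ultimately show "cut_weight x \<tau> = 0" by (simp add: cut_weight_outside)
      qed
    qed
    then show ?thesis by (simp add: cut_weight_eq[OF x])
  qed
  have eq': "(\<Sum>\<tau>\<in>Pow (supp x). cut_weight x \<tau>) = (\<Sum>\<tau>\<in>Pow \<sigma>. ?w \<tau> x)"
    if "x \<in> closed_simplex \<sigma>" for x
    using eq[OF that, of "\<lambda>_. True"] by (simp add: Pow_def)
  have "(\<Sum>\<tau>\<in>Pow \<sigma>. ?w \<tau> x) \<noteq> 0" if "x \<in> closed_simplex \<sigma>" for x
    using cut_weight_sum_pos[OF that] eq'[OF that] by simp
  moreover have "threshold x \<noteq> 0" if "x \<in> closed_simplex \<sigma>" for x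
    using threshold_pos[OF that] by simp
  ultimately have "continuous_on (closed_simplex \<sigma>)
      (\<lambda>x. (\<Sum>\<tau> | \<tau> \<subseteq> \<sigma> \<and> c \<tau> = i. ?w \<tau> x) / (\<Sum>\<tau>\<in>Pow \<sigma>. ?w \<tau> x))"
    by (intro continuous_intros continuous_on_coordinate continuous_on_threshold) auto
  then show "continuous_on (closed_simplex \<sigma>) (\<lambda>x. blend c x i)"
    by (rule continuous_on_eq) (simp add: blend_def eq eq')
qed

section \<open>The map of realizations induced by a vertex map\<close>

lemma realization_map_eq:
  assumes z: "z \<in> closed_simplex \<rho>"
  shows "realization_map f z a = (\<Sum>v | v \<in> \<rho> \<and> f v = a. z v)"
  unfolding realization_map_def
  using closed_simplex_finite[OF z] supp_closed_simplex[OF z]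
  by (intro sum.mono_neutral_left) (auto simp: supp_def)

text \<open>
  No cancellation occurs, because the coordinates are nonnegative.
\<close>

lemma supp_realization_map:
  assumes z: "z \<in> closed_simplex \<rho>"
  shows "supp (realization_map f z) = f ` supp z"
proof -
  have "finite {v. z v \<noteq> 0 \<and> f v = a}" for a
    using finite_supp[OF z] by (simp add: supp_def)
  then have "realization_map f z a = 0 \<longleftrightarrow> (\<forall>v\<in>{v. z v \<noteq> 0 \<and> f v = a}. z v = 0)" for a
    unfolding realization_map_def using closed_simplex_nonneg[OF z]
    by (intro sum_nonneg_eq_0_iff) auto
  then have "realization_map f z a \<noteq> 0 \<longleftrightarrow> a \<in> f ` supp z" for a
    unfolding supp_def by blast
  then show ?thesis unfolding supp_def[of "realization_map f z"] by simp
qed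

lemma realization_map_closed_simplex:
  assumes z: "z \<in> closed_simplex \<rho>"
  shows "realization_map f z \<in> closed_simplex (f ` \<rho>)"
proof (rule closed_simplexI)
  show "0 \<le> realization_map f z a" for a
    using closed_simplex_nonneg[OF z] by (simp add: realization_map_def sum_nonneg)
  show "supp (realization_map f z) \<subseteq> f ` \<rho>"
    unfolding supp_realization_map[OF z] using supp_closed_simplex[OF z] by (rule image_mono)
  have "(\<Sum>a\<in>f ` \<rho>. \<Sum>v\<in>{v \<in> \<rho>. f v = a}. z v) = sum z \<rho>"
    using closed_simplex_finite[OF z] by (intro sum.image_gen[symmetric])
  then show "sum (realization_map f z) (f ` \<rho>) = 1"
    using z by (simp add: realization_map_eq[OF z] closed_simplex_def)
qed

lemma continuous_on_realization_map: "continuous_on (closed_simplex \<rho>) (realization_map f)"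
proof (rule continuous_on_coordinatewise_then_product)
  fix a
  have "continuous_on (closed_simplex \<rho>) (\<lambda>z. \<Sum>v | v \<in> \<rho> \<and> f v = a. z v)"
    by (intro continuous_intros continuous_on_coordinate)
  then show "continuous_on (closed_simplex \<rho>) (\<lambda>z. realization_map f z a)"
    by (rule continuous_on_eq) (simp add: realization_map_eq)
qed

lemma simplexwise_continuous_realization_map:
  assumes "abstract_complex_on V S"
  shows "simplexwise_continuous S (realization_map f)"
  unfolding simplexwise_continuous_def
proof (intro ballI conjI exI)
  fix \<sigma> assume "\<sigma> \<in> S"
  then show "finite (f ` \<sigma>)"
    using assms by (auto simp: abstract_complex_on_def nonempty_finite_subsets_def)
  show "supp (realization_map f x) \<subseteq> f ` \<sigma>" if "x \<in> closed_simplex \<sigma>" for x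
    using that by (intro supp_closed_simplex realization_map_closed_simplex)
qed (rule continuous_on_realization_map)

lemma simplexwise_continuous_id:
  assumes "abstract_complex_on V S"
  shows "simplexwise_continuous S id"
  unfolding simplexwise_continuous_def id_apply
proof (intro ballI conjI exI)
  fix \<sigma> x assume "\<sigma> \<in> S"
  then show "finite \<sigma>"
    using assms by (auto simp: abstract_complex_on_def nonempty_finite_subsets_def)
  show "supp x \<subseteq> \<sigma>" if "x \<in> closed_simplex \<sigma>"
    using that by (rule supp_closed_simplex)
qed (simp add: continuous_on_id)

section \<open>Product measures\<close>

text \<open>
  The product of measures \<open>\<mu>\<close> and \<open>\<nu>\<close> when \<open>V\<close> is identified with a set of pairs
  by \<open>v \<mapsto> (p v, q v)\<close>. Working with \<open>p\<close> and \<open>q\<close> rather than with actual pairs allows tuples to be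
  used as vertices directly.
\<close>

definition product_measure ::
    "'v set \<Rightarrow> ('v \<Rightarrow> 'x) \<Rightarrow> ('v \<Rightarrow> 'y) \<Rightarrow> ('x \<Rightarrow> real) \<Rightarrow> ('y \<Rightarrow> real) \<Rightarrow> 'v \<Rightarrow> real"
  where "product_measure V p q \<mu> \<nu> = (\<lambda>v. if v \<in> V then \<mu> (p v) * \<nu> (q v) else 0)"

lemma continuous_on_product_measure:
  assumes "continuous_on A f" "continuous_on A g"
  shows "continuous_on A (\<lambda>x. product_measure V p q (f x) (g x))"
proof (rule continuous_on_coordinatewise_then_product)
  fix v
  show "continuous_on A (\<lambda>x. product_measure V p q (f x) (g x) v)"
  proof (cases "v \<in> V")
    case True
    then show ?thesis
      using assms[THEN continuous_on_product_then_coordinatewise]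
      by (simp add: product_measure_def continuous_on_mult)
  qed (simp add: product_measure_def)
qed

lemma supp_product_measure:
  "supp (product_measure V p q \<mu> \<nu>) = {v \<in> V. p v \<in> supp \<mu> \<and> q v \<in> supp \<nu>}"
  by (auto simp: supp_def product_measure_def)

lemma finite_product_fibre:
  assumes "inj_on (\<lambda>v. (p v, q v)) V" "finite \<sigma>" "finite \<nu>"
  shows "finite {v \<in> V. p v \<in> \<sigma> \<and> q v \<in> \<nu>}"
proof -
  have inj: "inj_on (\<lambda>v. (p v, q v)) {v \<in> V. p v \<in> \<sigma> \<and> q v \<in> \<nu>}"
    using assms(1) by (rule inj_on_subset) auto
  have "(\<lambda>v. (p v, q v)) ` {v \<in> V. p v \<in> \<sigma> \<and> q v \<in> \<nu>} \<subseteq> \<sigma> \<times> \<nu>"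
    by auto
  then have "finite ((\<lambda>v. (p v, q v)) ` {v \<in> V. p v \<in> \<sigma> \<and> q v \<in> \<nu>})"
    by (rule finite_subset) (intro finite_cartesian_product assms)
  then show ?thesis using inj by (rule finite_imageD)
qed

lemma product_measure_closed_simplex:
  assumes bij: "bij_betw (\<lambda>v. (p v, q v)) V (X \<times> Y)"
    and \<mu>: "\<mu> \<in> closed_simplex \<sigma>" "\<sigma> \<subseteq> X" and \<nu>: "\<nu> \<in> closed_simplex \<tau>" "\<tau> \<subseteq> Y"
  shows "product_measure V p q \<mu> \<nu> \<in> closed_simplex {v \<in> V. p v \<in> \<sigma> \<and> q v \<in> \<tau>}"
proof (rule closed_simplexI)
  let ?P = "{v \<in> V. p v \<in> \<sigma> \<and> q v \<in> \<tau>}"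
  have "bij_betw (\<lambda>v. (p v, q v)) ?P (\<sigma> \<times> \<tau>)"
  proof (rule bij_betw_subset[OF bij])
    have "\<sigma> \<times> \<tau> \<subseteq> (\<lambda>v. (p v, q v)) ` V"
      using bij \<mu>(2) \<nu>(2) by (auto simp: bij_betw_def)
    then show "(\<lambda>v. (p v, q v)) ` ?P = \<sigma> \<times> \<tau>" by force
  qed auto
  then have "(\<Sum>v\<in>?P. \<mu> (p v) * \<nu> (q v)) = (\<Sum>(a, b)\<in>\<sigma> \<times> \<tau>. \<mu> a * \<nu> b)"
    using sum.reindex_bij_betw[of "\<lambda>v. (p v, q v)" ?P "\<sigma> \<times> \<tau>" "\<lambda>(a, b). \<mu> a * \<nu> b"] by simp
  also have "\<dots> = sum \<mu> \<sigma> * sum \<nu> \<tau>"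
    by (simp add: sum.cartesian_product[symmetric] sum_product)
  also have "\<dots> = 1" using \<mu> \<nu> by (simp add: closed_simplex_def)
  finally show "sum (product_measure V p q \<mu> \<nu>) ?P = 1"
    by (simp add: product_measure_def)
  show "supp (product_measure V p q \<mu> \<nu>) \<subseteq> ?P"
    using supp_closed_simplex[OF \<mu>(1)] supp_closed_simplex[OF \<nu>(1)]
    by (auto simp: supp_product_measure)
qed (use \<mu> \<nu> in \<open>auto simp: product_measure_def closed_simplex_nonneg\<close>)

lemma realization_map_product_measure:
  assumes bij: "bij_betw (\<lambda>v. (p v, q v)) V (X \<times> Y)"
    and \<mu>: "\<mu> \<in> closed_simplex \<sigma>" "\<sigma> \<subseteq> X" and \<nu>: "\<nu> \<in> closed_simplex \<tau>" "\<tau> \<subseteq> Y"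
  shows "realization_map p (product_measure V p q \<mu> \<nu>) = \<mu>"
proof
  fix a
  let ?P = "{v \<in> V. p v \<in> \<sigma> \<and> q v \<in> \<tau>}"
  have "realization_map p (product_measure V p q \<mu> \<nu>) a =
      (\<Sum>v | v \<in> ?P \<and> p v = a. product_measure V p q \<mu> \<nu> v)"
    by (rule realization_map_eq[OF product_measure_closed_simplex[OF assms]])
  also have "\<dots> = (\<Sum>v | v \<in> ?P \<and> p v = a. \<mu> a * \<nu> (q v))"
    by (intro sum.cong) (auto simp: product_measure_def)
  finally have *: "realization_map p (product_measure V p q \<mu> \<nu>) a =
      (\<Sum>v | v \<in> ?P \<and> p v = a. \<mu> a * \<nu> (q v))" .
  show "realization_map p (product_measure V p q \<mu> \<nu>) a = \<mu> a"
  proof (cases "a \<in> \<sigma>")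
    case True
    then have a: "a \<in> X" using \<mu> by blast
    have surj: "(\<lambda>v. (p v, q v)) ` V = X \<times> Y" and inj: "inj_on (\<lambda>v. (p v, q v)) V"
      using bij by (auto simp: bij_betw_def)
    have "bij_betw q {v \<in> ?P. p v = a} \<tau>"
      unfolding bij_betw_def
    proof
      show "inj_on q {v \<in> ?P. p v = a}"
        using inj by (auto simp: inj_on_def)
      have "b \<in> q ` {v \<in> ?P. p v = a}" if "b \<in> \<tau>" for b
      proof -
        have "(a, b) \<in> (\<lambda>v. (p v, q v)) ` V" using surj a that \<nu>(2) by blast
        then show ?thesis using True that by force
      qed
      then show "q ` {v \<in> ?P. p v = a} = \<tau>" by auto
    qed
    then have "(\<Sum>v | v \<in> ?P \<and> p v = a. \<mu> a * \<nu> (q v)) = (\<Sum>b\<in>\<tau>. \<mu> a * \<nu> b)"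
      using sum.reindex_bij_betw[of q "{v \<in> ?P. p v = a}" \<tau> "\<lambda>b. \<mu> a * \<nu> b"] by simp
    also have "\<dots> = \<mu> a"
      using \<nu> by (simp add: closed_simplex_def flip: sum_distrib_left)
    finally show ?thesis
      unfolding * .
  next
    case False
    then have "\<mu> a = 0" using \<mu> by (auto simp: closed_simplex_def)
    then show ?thesis unfolding * by simp
  qed
qed

section \<open>Complexes of pairs over a family of subcomplexes\<close>

lemma abstract_complex_on_UN:
  assumes "\<And>i. i \<in> Y \<Longrightarrow> abstract_complex_on X (L i)"
  shows "abstract_complex_on X (\<Union>i\<in>Y. L i)"
  unfolding abstract_complex_on_def
proof (intro conjI ballI impI)
  show "(\<Union>i\<in>Y. L i) \<subseteq> nonempty_finite_subsets X"
    using assms by (intro UN_least) (simp add: abstract_complex_on_def)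
next
  fix \<sigma> \<tau> assume "\<sigma> \<in> (\<Union>i\<in>Y. L i)" and \<tau>: "\<tau> \<in> nonempty_finite_subsets X" "\<tau> \<subseteq> \<sigma>"
  then obtain i where "i \<in> Y" "\<sigma> \<in> L i" by blast
  then have "\<tau> \<in> L i" using assms[of i] \<tau> by (simp add: abstract_complex_on_def)
  then show "\<tau> \<in> (\<Union>i\<in>Y. L i)" using \<open>i \<in> Y\<close> by blast
qed

text \<open>
  For \<open>V = X \<times> Y\<close> with projections \<open>p\<close> and \<open>q\<close>, the fibre over an interior point \<open>x\<close> of a simplex
  \<open>\<sigma>\<close> of \<open>\<Union>i. L i\<close> consists of all finitely supported probability measures on \<open>\<sigma> \<times> {i. \<sigma> \<in> L i}\<close>
  with first marginal \<open>x\<close>, and is thus convex and nonempty.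
\<close>

definition cover_complex ::
    "'v set \<Rightarrow> ('v \<Rightarrow> 'x) \<Rightarrow> ('v \<Rightarrow> 'y) \<Rightarrow> ('y \<Rightarrow> 'x set set) \<Rightarrow> 'v set set"
  where "cover_complex V p q L = {\<rho> \<in> nonempty_finite_subsets V. \<forall>i\<in>q ` \<rho>. p ` \<rho> \<in> L i}"

lemma abstract_complex_on_cover_complex:
  assumes L: "\<And>i. i \<in> Y \<Longrightarrow> abstract_complex_on X (L i)"
    and "p \<in> V \<rightarrow> X" "q \<in> V \<rightarrow> Y"
  shows "abstract_complex_on V (cover_complex V p q L)"
  unfolding abstract_complex_on_def
proof (intro conjI ballI impI)
  fix \<rho> \<tau> assume \<rho>: "\<rho> \<in> cover_complex V p q L" and \<tau>: "\<tau> \<in> nonempty_finite_subsets V" "\<tau> \<subseteq> \<rho>"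
  have "p ` \<tau> \<in> L i" if "i \<in> q ` \<tau>" for i
  proof -
    have "p ` \<rho> \<in> L i" "i \<in> Y"
      using \<rho> \<tau> that assms(3) by (auto simp: cover_complex_def nonempty_finite_subsets_def)
    moreover have "p ` \<tau> \<in> nonempty_finite_subsets X"
      using \<tau> assms(2) by (auto simp: nonempty_finite_subsets_def)
    moreover have "p ` \<tau> \<subseteq> p ` \<rho>" using \<tau> by blast
    ultimately show ?thesis using L[of i] unfolding abstract_complex_on_def by blast
  qed
  then show "\<tau> \<in> cover_complex V p q L"
    using \<tau> by (auto simp: cover_complex_def)
qed (auto simp: cover_complex_def)

text \<open>
  A simplex \<open>\<sigma>\<close> of \<open>L i\<close> is the image of its copy \<open>\<sigma> \<times> {i}\<close>.
\<close>

lemma cover_complex_surjective: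
  assumes bij: "bij_betw (\<lambda>v. (p v, q v)) V (X \<times> Y)"
    and L: "\<And>i. i \<in> Y \<Longrightarrow> abstract_complex_on X (L i)"
  shows "surjective_simplicial_map V (cover_complex V p q L) X (\<Union>i\<in>Y. L i) p"
  unfolding surjective_simplicial_map_def simplicial_map_def
proof (intro conjI ballI)
  show pX: "p \<in> V \<rightarrow> X"
    using bij_betw_apply[OF bij] by (intro Pi_I) simp
  have qY: "q \<in> V \<rightarrow> Y"
    using bij_betw_apply[OF bij] by (intro Pi_I) simp
  show "abstract_complex_on V (cover_complex V p q L)"
    by (rule abstract_complex_on_cover_complex[OF L pX qY])
  show "abstract_complex_on X (\<Union>i\<in>Y. L i)"
    by (rule abstract_complex_on_UN[OF L])
next
  fix \<rho> assume \<rho>: "\<rho> \<in> cover_complex V p q L"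
  then obtain v where "v \<in> \<rho>" "v \<in> V"
    by (auto simp: cover_complex_def nonempty_finite_subsets_def)
  moreover from this have "q v \<in> Y" using bij_betw_apply[OF bij, of v] by auto
  ultimately show "p ` \<rho> \<in> (\<Union>i\<in>Y. L i)"
    using \<rho> by (auto simp: cover_complex_def)
next
  fix \<sigma> assume "\<sigma> \<in> (\<Union>i\<in>Y. L i)"
  then obtain i where i: "i \<in> Y" "\<sigma> \<in> L i" by blast
  then have \<sigma>: "\<sigma> \<subseteq> X" "finite \<sigma>" "\<sigma> \<noteq> {}"
    using L[OF i(1)] by (auto simp: abstract_complex_on_def nonempty_finite_subsets_def)
  let ?\<rho> = "{v \<in> V. p v \<in> \<sigma> \<and> q v \<in> {i}}"
  have img: "p ` ?\<rho> = \<sigma>"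
  proof
    show "\<sigma> \<subseteq> p ` ?\<rho>"
    proof
      fix a assume "a \<in> \<sigma>"
      then have "(a, i) \<in> (\<lambda>v. (p v, q v)) ` V"
        using bij i(1) \<sigma>(1) by (auto simp: bij_betw_def)
      then show "a \<in> p ` ?\<rho>" using \<open>a \<in> \<sigma>\<close> by force
    qed
  qed auto
  have "finite ?\<rho>"
    using bij \<sigma>(2) by (intro finite_product_fibre) (auto simp: bij_betw_def)
  then have "?\<rho> \<in> nonempty_finite_subsets V"
    using img \<sigma>(3) by (auto simp: nonempty_finite_subsets_def)
  then have "?\<rho> \<in> cover_complex V p q L"
    using img i(2) by (auto simp: cover_complex_def)
  then show "\<exists>\<rho>\<in>cover_complex V p q L. p ` \<rho> = \<sigma>"
    using img by blast
qed

text \<open>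
  The homotopy inverse is the map \<open>g\<close> below. Since no simplex need contain both \<open>z\<close> and its image
  under the round trip, the homotopy from the identity passes through the intermediate map \<open>h\<close>,
  which trims the first marginal but keeps the second.
\<close>

proposition homotopy_equivalence_cover_complex:
  assumes bij: "bij_betw (\<lambda>v. (p v, q v)) V (X \<times> Y)"
    and L: "\<And>i. i \<in> Y \<Longrightarrow> abstract_complex_on X (L i)"
  shows "homotopy_equivalence_map (realization (cover_complex V p q L))
    (realization (\<Union>i\<in>Y. L i)) (realization_map p)"
proof -
  let ?S = "cover_complex V p q L" and ?T = "\<Union>i\<in>Y. L i"
  let ?\<phi> = "realization_map p"
  have inj: "inj_on (\<lambda>v. (p v, q v)) V"
    using bij by (simp add: bij_betw_def)
  have pq: "p \<in> V \<rightarrow> X" "q \<in> V \<rightarrow> Y"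
    using bij_betw_apply[OF bij] by (intro Pi_I, simp)+
  have S: "abstract_complex_on V ?S"
    by (rule abstract_complex_on_cover_complex[OF L pq])
  have T: "abstract_complex_on X ?T"
    by (rule abstract_complex_on_UN[OF L])
  have TX: "\<sigma> \<subseteq> X" "finite \<sigma>" if "\<sigma> \<in> ?T" for \<sigma>
    using T that by (auto simp: abstract_complex_on_def nonempty_finite_subsets_def)
  have face: "\<tau> \<in> L i" if "\<sigma> \<in> L i" "i \<in> Y" "\<tau> \<subseteq> \<sigma>" "\<tau> \<noteq> {}" for \<sigma> \<tau> i
  proof -
    have "\<tau> \<in> nonempty_finite_subsets X"
      using L[OF that(2)] that
      by (auto simp: abstract_complex_on_def nonempty_finite_subsets_def intro: finite_subset)
    then show ?thesis using L[OF that(2)] that unfolding abstract_complex_on_def by blast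
  qed
  \<comment> \<open>As each \<open>L i\<close> is closed under faces, it suffices to bound the first projection by one \<open>\<sigma>\<close>
    that lies in all the subcomplexes concerned.\<close>
  have S_memb: "\<rho> \<in> ?S"
    if "\<rho> \<subseteq> V" "finite \<rho>" "\<rho> \<noteq> {}" "p ` \<rho> \<subseteq> \<sigma>" "\<And>i. i \<in> q ` \<rho> \<Longrightarrow> \<sigma> \<in> L i" for \<rho> \<sigma>
  proof -
    have "p ` \<rho> \<in> L i" if i: "i \<in> q ` \<rho>" for i
    proof (rule face)
      show "\<sigma> \<in> L i" by (rule \<open>\<And>i. i \<in> q ` \<rho> \<Longrightarrow> \<sigma> \<in> L i\<close>[OF i])
      show "i \<in> Y" using i \<open>\<rho> \<subseteq> V\<close> pq(2) by blast
    qed (use \<open>p ` \<rho> \<subseteq> \<sigma>\<close> \<open>\<rho> \<noteq> {}\<close> in auto)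
    then show ?thesis
      using that(1,2,3) by (simp add: cover_complex_def nonempty_finite_subsets_def)
  qed
  have S_V: "\<rho> \<subseteq> V" "finite \<rho>" "\<rho> \<noteq> {}" "p ` \<rho> \<subseteq> X" "q ` \<rho> \<subseteq> Y" if "\<rho> \<in> ?S" for \<rho>
    using that pq by (auto simp: cover_complex_def nonempty_finite_subsets_def)
  have S_L: "p ` \<rho> \<in> L i" if "\<rho> \<in> ?S" "i \<in> q ` \<rho>" for \<rho> i
    using that by (auto simp: cover_complex_def)
  have S_T: "p ` \<rho> \<in> ?T" if "\<rho> \<in> ?S" for \<rho>
  proof -
    have "\<rho> \<noteq> {}" by (rule S_V(3)[OF that])
    then obtain v where "v \<in> \<rho>" by blast
    then have "q v \<in> Y" "p ` \<rho> \<in> L (q v)"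
      using S_V(5)[OF that] S_L[OF that, of "q v"] by auto
    then show ?thesis by blast
  qed
  note S_iff = topspace_realization_iff[OF S] and T_iff = topspace_realization_iff[OF T]
  have "\<exists>i. i \<in> Y \<and> \<sigma> \<in> L i" if "\<sigma> \<in> ?T" for \<sigma>
    using that by blast
  then obtain c where c: "\<And>\<sigma>. \<sigma> \<in> ?T \<Longrightarrow> c \<sigma> \<in> Y \<and> \<sigma> \<in> L (c \<sigma>)"
    by metis
  define g where "g x = product_measure V p q (trim x) (blend c x)" for x
  define h where "h z = product_measure V p q (trim (?\<phi> z)) (realization_map q z)" for z

  have \<phi>T: "?\<phi> z \<in> topspace (realization ?T)" if "z \<in> topspace (realization ?S)" for z
    using that S_T realization_map_closed_simplex[of z] by (fastforce simp: topspace_realization)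
  have trimT: "trim x \<in> topspace (realization ?T)" if "x \<in> topspace (realization ?T)" for x
    using that trim_closed_simplex[of x] T_iff[of x] unfolding topspace_realization[of ?T] by blast
  have blend_supp: "i \<in> Y \<and> supp (trim x) \<in> L i"
    if x: "x \<in> topspace (realization ?T)" and i: "i \<in> supp (blend c x)" for x i
  proof -
    have xs: "x \<in> closed_simplex (supp x)" "supp x \<in> ?T" using x T_iff by blast+
    obtain \<tau> where \<tau>: "\<tau> \<subseteq> supp x" "supp (trim x) \<subseteq> \<tau>" "c \<tau> = i"
      using supp_blend[OF xs(1) i] by blast
    have ne: "supp (trim x) \<noteq> {}" using supp_nonempty[OF trim_closed_simplex[OF xs(1)]] .
    obtain j where j: "j \<in> Y" "supp x \<in> L j" using xs(2) by blast
    \<comment> \<open>The choice \<open>c\<close> is meaningful at \<open>\<tau>\<close> because \<open>\<tau>\<close> is a face of the support of \<open>x\<close>.\<close>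
    have "\<tau> \<in> L j" using \<tau>(2) ne by (intro face[OF j(2,1) \<tau>(1)]) auto
    then have "i \<in> Y" "\<tau> \<in> L i" using c[of \<tau>] j(1) \<tau>(3) by blast+
    then show ?thesis using face[OF _ _ \<tau>(2) ne] by simp
  qed
  have trim_cs: "trim x \<in> closed_simplex (supp (trim x))" "supp (trim x) \<subseteq> X"
    and blend_cs: "blend c x \<in> closed_simplex (supp (blend c x))" "supp (blend c x) \<subseteq> Y"
    if x: "x \<in> topspace (realization ?T)" for x
  proof -
    have xs: "x \<in> closed_simplex (supp x)" using x T_iff by blast
    show "trim x \<in> closed_simplex (supp (trim x))" "supp (trim x) \<subseteq> X"
      using trimT[OF x] T_iff TX by blast+
    show "blend c x \<in> closed_simplex (supp (blend c x))"
      by (rule closed_simplex_supp[OF blend_closed_simplex[OF xs]])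
    show "supp (blend c x) \<subseteq> Y" using blend_supp[OF x] by blast
  qed
  have g_cs: "g x \<in> closed_simplex {v \<in> V. p v \<in> supp (trim x) \<and> q v \<in> supp (blend c x)}"
    if "x \<in> topspace (realization ?T)" for x
    unfolding g_def by (intro product_measure_closed_simplex[OF bij] trim_cs blend_cs that)
  have gS: "g x \<in> topspace (realization ?S)" if x: "x \<in> topspace (realization ?T)" for x
  proof -
    have "supp (g x) \<in> ?S"
    proof (rule S_memb)
      show "finite (supp (g x))" "supp (g x) \<noteq> {}"
        using finite_supp[OF g_cs[OF x]] supp_nonempty[OF g_cs[OF x]] .
      show "supp (trim x) \<in> L i" if "i \<in> q ` supp (g x)" for i
        using that blend_supp[OF x] by (auto simp: g_def supp_product_measure)
    qed (auto simp: g_def supp_product_measure)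
    then show ?thesis using S_iff closed_simplex_supp[OF g_cs[OF x]] by blast
  qed
  have \<phi>g: "?\<phi> (g x) = trim x" if "x \<in> topspace (realization ?T)" for x
    unfolding g_def
    by (rule realization_map_product_measure[OF bij trim_cs[OF that] blend_cs[OF that]])

  have supp_trim_\<phi>: "supp (trim (?\<phi> z)) \<subseteq> p ` supp z" if "z \<in> topspace (realization ?S)" for z
  proof -
    have z: "z \<in> closed_simplex (supp z)" using that S_iff by blast
    show ?thesis
      using supp_trim_subset[OF realization_map_closed_simplex[OF z, of p]] supp_realization_map[OF z, of p]
      by simp
  qed
  have supp_h: "supp (h z) \<subseteq> {v \<in> V. p v \<in> p ` supp z \<and> q v \<in> q ` supp z}"
    if "z \<in> topspace (realization ?S)" for z
    using supp_trim_\<phi>[OF that] supp_realization_map[of z "supp z" q] that S_iff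
    by (auto simp: h_def supp_product_measure)
  have h_cs: "h z \<in> closed_simplex {v \<in> V. p v \<in> supp (trim (?\<phi> z)) \<and> q v \<in> q ` supp z}"
    if z: "z \<in> topspace (realization ?S)" for z
  proof -
    have zS: "supp z \<in> ?S" and z': "z \<in> closed_simplex (supp z)"
      using z unfolding S_iff by blast+
    show ?thesis
      unfolding h_def
      by (rule product_measure_closed_simplex[OF bij trim_cs[OF \<phi>T[OF z]]
            realization_map_closed_simplex[OF z'] S_V(5)[OF zS]])
  qed
  have h_proj: "supp (h z) \<subseteq> V" "p ` supp (h z) \<subseteq> p ` supp z" "q ` supp (h z) \<subseteq> q ` supp z"
    if z: "z \<in> topspace (realization ?S)" for z
  proof -
    have "v \<in> V \<and> p v \<in> p ` supp z \<and> q v \<in> q ` supp z" if "v \<in> supp (h z)" for v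
      using subsetD[OF supp_h[OF z] that] by simp
    then show "supp (h z) \<subseteq> V" "p ` supp (h z) \<subseteq> p ` supp z" "q ` supp (h z) \<subseteq> q ` supp z"
      by (simp_all add: subsetI image_subset_iff)
  qed
  \<comment> \<open>The segment from \<open>z\<close> to \<open>h z\<close> stays in the box spanned by the support of \<open>z\<close>.\<close>
  have hS: "supp z \<union> supp (h z) \<in> ?S" if z: "z \<in> topspace (realization ?S)" for z
  proof (rule S_memb)
    have zS: "supp z \<in> ?S" using z unfolding S_iff by blast
    show "supp z \<union> supp (h z) \<subseteq> V" "finite (supp z \<union> supp (h z))" "supp z \<union> supp (h z) \<noteq> {}"
      using S_V(1-3)[OF zS] finite_supp[OF h_cs[OF z]] h_proj(1)[OF z] by simp_all
    show "p ` (supp z \<union> supp (h z)) \<subseteq> p ` supp z"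
      using h_proj(2)[OF z] by (simp add: image_Un)
    show "p ` supp z \<in> L i" if "i \<in> q ` (supp z \<union> supp (h z))" for i
      using that h_proj(3)[OF z] by (intro S_L[OF zS]) (simp add: image_Un sup.absorb1)
  qed
  have hT: "h z \<in> topspace (realization ?S)" if z: "z \<in> topspace (realization ?S)" for z
  proof -
    have "supp (h z) \<in> nonempty_finite_subsets V"
      using finite_supp[OF h_cs[OF z]] supp_nonempty[OF h_cs[OF z]] h_proj(1)[OF z]
      by (simp add: nonempty_finite_subsets_def)
    then have "supp (h z) \<in> ?S"
      using S hS[OF z] unfolding abstract_complex_on_def by blast
    then show ?thesis
      using closed_simplex_supp[OF h_cs[OF z]] unfolding S_iff by (rule conjI)
  qed
  \<comment> \<open>On the segment from \<open>h z\<close> to \<open>g (?\<phi> z)\<close> the first projection is the support of the trimmed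
    marginal, which lies in \<open>L i\<close> for the indices of both ends.\<close>
  have hgS: "supp (h z) \<union> supp (g (?\<phi> z)) \<in> ?S" if z: "z \<in> topspace (realization ?S)" for z
  proof (rule S_memb)
    have zS: "supp z \<in> ?S" using z unfolding S_iff by blast
    note g = g_cs[OF \<phi>T[OF z]]
    show "supp (h z) \<union> supp (g (?\<phi> z)) \<subseteq> V" "p ` (supp (h z) \<union> supp (g (?\<phi> z))) \<subseteq> supp (trim (?\<phi> z))"
      by (auto simp: h_def g_def supp_product_measure)
    show "finite (supp (h z) \<union> supp (g (?\<phi> z)))" "supp (h z) \<union> supp (g (?\<phi> z)) \<noteq> {}"
      using finite_supp[OF h_cs[OF z]] finite_supp[OF g] supp_nonempty[OF g] by simp_all
    fix i assume "i \<in> q ` (supp (h z) \<union> supp (g (?\<phi> z)))"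
    then consider "i \<in> q ` supp (h z)" | "i \<in> q ` supp (g (?\<phi> z))"
      by (auto simp only: image_Un)
    then consider "i \<in> q ` supp z" | "i \<in> supp (blend c (?\<phi> z))"
    proof cases
      case 1
      then show ?thesis using h_proj(3)[OF z] that(1) by blast
    next
      case 2
      then show ?thesis using that(2) by (auto simp: g_def supp_product_measure)
    qed
    then show "supp (trim (?\<phi> z)) \<in> L i"
    proof cases
      case 1
      then have "i \<in> Y" using S_V(5)[OF zS] by blast
      then show ?thesis
        by (rule face[OF S_L[OF zS 1] _ supp_trim_\<phi>[OF z] supp_nonempty[OF trim_cs(1)[OF \<phi>T[OF z]]]])
    next
      case 2
      then show ?thesis using blend_supp[OF \<phi>T[OF z]] by blast
    qed
  qed

  have \<phi>_swc: "simplexwise_continuous ?S ?\<phi>"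
    by (rule simplexwise_continuous_realization_map[OF S])
  have \<phi>_cont: "continuous_map (realization ?S) (realization ?T) ?\<phi>"
    by (intro continuous_map_simplexwise[OF T \<phi>_swc] Pi_I \<phi>T)
  have trim_swc: "simplexwise_continuous ?T trim"
    unfolding simplexwise_continuous_def
  proof (intro ballI conjI exI)
    fix \<sigma> x assume "\<sigma> \<in> ?T"
    then show "finite \<sigma>" by (rule TX)
    show "supp (trim x) \<subseteq> \<sigma>" if "x \<in> closed_simplex \<sigma>"
      using supp_trim_subset[OF that] supp_closed_simplex[OF that] by blast
  qed (rule continuous_on_trim)
  have g_cont: "continuous_on (closed_simplex \<sigma>) g" if "finite \<sigma>" for \<sigma>
    unfolding g_def
    by (intro continuous_on_product_measure continuous_on_trim continuous_on_blend that)
  have g_supp: "supp (g x) \<subseteq> {v \<in> V. p v \<in> \<sigma> \<and> q v \<in> c ` Pow \<sigma>}" if x: "x \<in> closed_simplex \<sigma>" for x \<sigma>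
  proof -
    have "supp (trim x) \<subseteq> \<sigma>"
      using supp_trim_subset[OF x] supp_closed_simplex[OF x] by (rule order_trans)
    moreover have "supp (blend c x) \<subseteq> c ` Pow \<sigma>"
      using supp_closed_simplex[OF blend_closed_simplex[OF x, of c]]
        image_mono[OF Pow_mono[OF supp_closed_simplex[OF x]]] by (rule order_trans)
    ultimately show ?thesis
      unfolding g_def supp_product_measure by (simp add: Collect_mono_iff subset_iff)
  qed
  have g_fin: "finite {v \<in> V. p v \<in> \<sigma> \<and> q v \<in> c ` Pow \<sigma>}" if "finite \<sigma>" for \<sigma>
    using that by (intro finite_product_fibre[OF inj]) auto
  have g_swc: "simplexwise_continuous ?T g"
    unfolding simplexwise_continuous_def
  proof (intro ballI conjI exI)
    fix \<sigma> x assume "\<sigma> \<in> ?T"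
    then have fin: "finite \<sigma>" by (rule TX)
    show "continuous_on (closed_simplex \<sigma>) g" by (rule g_cont[OF fin])
    show "finite {v \<in> V. p v \<in> \<sigma> \<and> q v \<in> c ` Pow \<sigma>}" by (rule g_fin[OF fin])
    show "supp (g x) \<subseteq> {v \<in> V. p v \<in> \<sigma> \<and> q v \<in> c ` Pow \<sigma>}" if "x \<in> closed_simplex \<sigma>"
      by (rule g_supp[OF that])
  qed
  have g_map: "continuous_map (realization ?T) (realization ?S) g"
    by (intro continuous_map_simplexwise[OF S g_swc] Pi_I gS)
  have \<phi>_image: "?\<phi> ` closed_simplex \<rho> \<subseteq> closed_simplex (p ` \<rho>)" for \<rho>
    by (intro image_subsetI realization_map_closed_simplex)
  have g\<phi>_swc: "simplexwise_continuous ?S (g \<circ> ?\<phi>)"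
    unfolding simplexwise_continuous_def
  proof (intro ballI conjI exI)
    fix \<rho> assume "\<rho> \<in> ?S"
    then have fin: "finite (p ` \<rho>)" by (intro finite_imageI S_V(2))
    show "continuous_on (closed_simplex \<rho>) (g \<circ> ?\<phi>)"
      by (intro continuous_on_compose continuous_on_realization_map
          continuous_on_subset[OF g_cont[OF fin] \<phi>_image])
    show "supp ((g \<circ> ?\<phi>) z) \<subseteq> {v \<in> V. p v \<in> p ` \<rho> \<and> q v \<in> c ` Pow (p ` \<rho>)}"
      if "z \<in> closed_simplex \<rho>" for z
      unfolding comp_apply by (rule g_supp[OF realization_map_closed_simplex[OF that]])
    show "finite {v \<in> V. p v \<in> p ` \<rho> \<and> q v \<in> c ` Pow (p ` \<rho>)}"
      by (rule g_fin[OF fin])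
  qed
  have h_swc: "simplexwise_continuous ?S h"
    unfolding simplexwise_continuous_def
  proof (intro ballI conjI exI)
    fix \<rho> assume \<rho>: "\<rho> \<in> ?S"
    have "continuous_on (closed_simplex \<rho>) (\<lambda>z. trim (?\<phi> z))"
      by (rule continuous_on_compose2[OF continuous_on_trim continuous_on_realization_map \<phi>_image])
    then show "continuous_on (closed_simplex \<rho>) h"
      unfolding h_def by (intro continuous_on_product_measure continuous_on_realization_map)
    show "finite {v \<in> V. p v \<in> p ` \<rho> \<and> q v \<in> q ` \<rho>}"
      using S_V(2)[OF \<rho>] by (intro finite_product_fibre[OF inj]) auto
    show "supp (h z) \<subseteq> {v \<in> V. p v \<in> p ` \<rho> \<and> q v \<in> q ` \<rho>}" if z: "z \<in> closed_simplex \<rho>" for z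
    proof -
      have "z \<in> topspace (realization ?S)"
        using z \<rho> unfolding topspace_realization by blast
      then have "supp (h z) \<subseteq> {v \<in> V. p v \<in> p ` supp z \<and> q v \<in> q ` supp z}"
        by (rule supp_h)
      also have "\<dots> \<subseteq> {v \<in> V. p v \<in> p ` \<rho> \<and> q v \<in> q ` \<rho>}"
        using image_mono[OF supp_closed_simplex[OF z], of p]
          image_mono[OF supp_closed_simplex[OF z], of q] by fast
      finally show ?thesis .
    qed
  qed
  have "homotopic_with (\<lambda>x. True) (realization ?S) (realization ?S) id h"
    by (intro homotopic_straight_line[OF S simplexwise_continuous_id[OF S] h_swc] Pi_I hT)
      (simp_all add: hS)
  moreover have "homotopic_with (\<lambda>x. True) (realization ?S) (realization ?S) h (g \<circ> ?\<phi>)"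
    by (intro homotopic_straight_line[OF S h_swc g\<phi>_swc] Pi_I hT) (simp_all add: hgS gS \<phi>T)
  ultimately have 1: "homotopic_with (\<lambda>x. True) (realization ?S) (realization ?S) (g \<circ> ?\<phi>) id"
    by (meson homotopic_with_symD homotopic_with_trans)
  have "homotopic_with (\<lambda>x. True) (realization ?T) (realization ?T) trim id"
  proof (rule homotopic_straight_line[OF T trim_swc simplexwise_continuous_id[OF T]])
    fix x assume x: "x \<in> topspace (realization ?T)"
    then have "supp (trim x) \<union> supp (id x) = supp x"
      using supp_trim_subset[of x "supp x"] T_iff by auto
    then show "supp (trim x) \<union> supp (id x) \<in> ?T" using x T_iff by auto
  qed (use trimT in auto)
  then have 2: "homotopic_with (\<lambda>x. True) (realization ?T) (realization ?T) (?\<phi> \<circ> g) id"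
    by (rule homotopic_with_eq) (use \<phi>g in auto)
  show ?thesis
    unfolding homotopy_equivalence_map_def using \<phi>_cont g_map 1 2 by blast
qed

section \<open>Cuboid and Dowker complexes\<close>

lemma omit_PiE: "omit K k \<in> PiE K I \<rightarrow> PiE (K - {k}) I"
proof
  fix x assume "x \<in> PiE K I"
  then have "x j \<in> I j" if "j \<in> K - {k}" for j
    using PiE_mem[of x K I j] that by simp
  then show "omit K k x \<in> PiE (K - {k}) I"
    unfolding omit_def by (simp only: restrict_PiE_iff) blast
qed

lemma image_nonempty_finite_subsets:
  assumes "f \<in> A \<rightarrow> B" "\<sigma> \<in> nonempty_finite_subsets A"
  shows "f ` \<sigma> \<in> nonempty_finite_subsets B"
proof -
  have "\<sigma> \<subseteq> A" "finite \<sigma>" "\<sigma> \<noteq> {}"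
    using assms(2) by (simp_all add: nonempty_finite_subsets_def)
  then show ?thesis
    using subset_trans[OF image_mono funcset_image[OF assms(1)]]
    by (simp add: nonempty_finite_subsets_def)
qed

lemma bij_betw_omit_coordinate:
  assumes "k \<in> K"
  shows "bij_betw (\<lambda>x. (omit K k x, x k)) (PiE K I) (PiE (K - {k}) I \<times> I k)"
proof (rule bij_betw_byWitness[where f' = "\<lambda>z. (fst z)(k := snd z)"])
  show "\<forall>x\<in>PiE K I. (fst (omit K k x, x k))(k := snd (omit K k x, x k)) = x"
  proof
    fix x assume x: "x \<in> PiE K I"
    have "(omit K k x)(k := x k) = x"
    proof
      fix j show "((omit K k x)(k := x k)) j = x j"
      proof (cases "j = k")
        case False
        then show ?thesis
          using PiE_arb[OF x, of j] by (cases "j \<in> K") (simp_all add: omit_def)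
      next
        case True
        then show ?thesis by (simp only: fun_upd_same)
      qed
    qed
    then show "(fst (omit K k x, x k))(k := snd (omit K k x, x k)) = x"
      by (simp only: fst_conv snd_conv)
  qed
  show "\<forall>z\<in>PiE (K - {k}) I \<times> I k.
      (omit K k ((fst z)(k := snd z)), ((fst z)(k := snd z)) k) = z"
  proof
    fix z assume "z \<in> PiE (K - {k}) I \<times> I k"
    then have z: "fst z \<in> PiE (K - {k}) I" by (rule mem_Times_iff[THEN iffD1, THEN conjunct1])
    have "omit K k ((fst z)(k := snd z)) = fst z"
    proof
      fix j show "omit K k ((fst z)(k := snd z)) j = fst z j"
      proof (cases "j \<in> K - {k}")
        case True
        then show ?thesis by (simp add: omit_def)
      next
        case False
        show ?thesis unfolding omit_def restrict_apply if_not_P[OF False] PiE_arb[OF z False] ..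
      qed
    qed
    then show "(omit K k ((fst z)(k := snd z)), ((fst z)(k := snd z)) k) = z" by simp
  qed
  show "(\<lambda>x. (omit K k x, x k)) ` PiE K I \<subseteq> PiE (K - {k}) I \<times> I k"
  proof (rule image_subsetI)
    fix x assume x: "x \<in> PiE K I"
    have "omit K k x \<in> PiE (K - {k}) I" "x k \<in> I k"
      by (rule funcset_mem[OF omit_PiE x], rule PiE_mem[OF x assms])
    then show "(omit K k x, x k) \<in> PiE (K - {k}) I \<times> I k" by simp
  qed
  show "(\<lambda>z. (fst z)(k := snd z)) ` (PiE (K - {k}) I \<times> I k) \<subseteq> PiE K I"
  proof (rule image_subsetI)
    fix z assume "z \<in> PiE (K - {k}) I \<times> I k"
    then have "(fst z)(k := snd z) \<in> PiE (insert k (K - {k})) I"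
      by (intro PiE_fun_upd[of _ I k _ "K - {k}"]) (simp_all only: mem_Times_iff)
    then show "(fst z)(k := snd z) \<in> PiE K I"
      by (simp only: insert_Diff[OF assms])
  qed
qed

lemma abstract_complex_on_cuboid: "abstract_complex_on (PiE K I) (cuboid K I R)"
  unfolding abstract_complex_on_def
proof (intro conjI ballI impI)
  fix \<rho> \<tau> assume \<rho>: "\<rho> \<in> cuboid K I R"
    and \<tau>: "\<tau> \<in> nonempty_finite_subsets (PiE K I)" "\<tau> \<subseteq> \<rho>"
  have "PiE K (\<lambda>k. (\<lambda>x. x k) ` \<tau>) \<subseteq> PiE K (\<lambda>k. (\<lambda>x. x k) ` \<rho>)"
    using \<tau>(2) by (intro PiE_mono image_mono)
  also have "\<dots> \<subseteq> R"
    using \<rho> by (simp add: cuboid_def)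
  finally show "\<tau> \<in> cuboid K I R"
    using \<tau>(1) by (simp add: cuboid_def)
qed (simp add: cuboid_def)

lemma abstract_complex_on_dowker: "abstract_complex_on (PiE (K - {k}) I) (dowker K I R k)"
  unfolding dowker_def by (intro abstract_complex_on_UN abstract_complex_on_cuboid)

text \<open>
  A box is the union of its slices at the entries \<open>i\<close> of its \<open>k\<close>-th side, and it is contained in \<open>R\<close> if
  and only if the remaining box is contained in each slice of \<open>R\<close> at such an \<open>i\<close>.
\<close>

lemma cuboid_eq_cover_complex:
  assumes k: "k \<in> K"
  shows "cuboid K I R =
    cover_complex (PiE K I) (omit K k) (\<lambda>x. x k) (\<lambda>i. cuboid (K - {k}) I (slice K I R k i))"
proof -
  have eq: "PiE K (\<lambda>j. (\<lambda>x. x j) ` \<rho>) \<subseteq> R \<longleftrightarrow>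
      (\<forall>i\<in>(\<lambda>x. x k) ` \<rho>. omit K k ` \<rho> \<in> cuboid (K - {k}) I (slice K I R k i))"
    if \<rho>: "\<rho> \<in> nonempty_finite_subsets (PiE K I)" for \<rho>
  proof -
    have \<rho>': "\<rho> \<subseteq> PiE K I" "finite \<rho>" "\<rho> \<noteq> {}"
      using \<rho> by (simp_all add: nonempty_finite_subsets_def)
    have om: "omit K k ` \<rho> \<in> nonempty_finite_subsets (PiE (K - {k}) I)"
      by (rule image_nonempty_finite_subsets[OF omit_PiE \<rho>])
    have proj: "(\<lambda>x. x j) ` omit K k ` \<rho> = (\<lambda>x. x j) ` \<rho>" if "j \<in> K - {k}" for j
      using that by (simp add: omit_def image_image)
    have box: "PiE (K - {k}) (\<lambda>j. (\<lambda>x. x j) ` omit K k ` \<rho>) = PiE (K - {k}) (\<lambda>j. (\<lambda>x. x j) ` \<rho>)"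
      by (rule PiE_cong) (rule proj)
    have "(\<lambda>x. x j) ` \<rho> \<subseteq> I j" if "j \<in> K" for j
    proof (rule image_subsetI)
      fix x assume "x \<in> \<rho>"
      then show "x j \<in> I j" by (rule PiE_mem[OF subsetD[OF \<rho>'(1)] that])
    qed
    then have sub: "PiE (K - {k}) (\<lambda>j. (\<lambda>x. x j) ` \<rho>) \<subseteq> PiE (K - {k}) I"
      by (intro PiE_mono) (simp only: Diff_iff)
    have "PiE K (\<lambda>j. (\<lambda>x. x j) ` \<rho>) =
        (\<lambda>(i, y). y(k := i)) ` ((\<lambda>x. x k) ` \<rho> \<times> PiE (K - {k}) (\<lambda>j. (\<lambda>x. x j) ` \<rho>))"
      using PiE_insert_eq[of k "K - {k}" "\<lambda>j. (\<lambda>x. x j) ` \<rho>"] unfolding insert_Diff[OF k] .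
    then have "PiE K (\<lambda>j. (\<lambda>x. x j) ` \<rho>) \<subseteq> R \<longleftrightarrow>
        (\<forall>i\<in>(\<lambda>x. x k) ` \<rho>. \<forall>y\<in>PiE (K - {k}) (\<lambda>j. (\<lambda>x. x j) ` \<rho>). y(k := i) \<in> R)"
      by (simp only: image_subset_iff split_paired_Ball_Sigma prod.case)
    also have "\<dots> \<longleftrightarrow>
        (\<forall>i\<in>(\<lambda>x. x k) ` \<rho>. PiE (K - {k}) (\<lambda>j. (\<lambda>x. x j) ` \<rho>) \<subseteq> slice K I R k i)"
    proof (intro ball_cong refl)
      fix i
      show "(\<forall>y\<in>PiE (K - {k}) (\<lambda>j. (\<lambda>x. x j) ` \<rho>). y(k := i) \<in> R) \<longleftrightarrow>
          PiE (K - {k}) (\<lambda>j. (\<lambda>x. x j) ` \<rho>) \<subseteq> slice K I R k i"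
        unfolding slice_def subset_Collect_iff[OF sub] ..
    qed
    also have "\<dots> \<longleftrightarrow>
        (\<forall>i\<in>(\<lambda>x. x k) ` \<rho>. omit K k ` \<rho> \<in> cuboid (K - {k}) I (slice K I R k i))"
      unfolding cuboid_def[of "K - {k}"] mem_Collect_eq box using om by simp
    finally show ?thesis .
  qed
  show ?thesis
    unfolding cover_complex_def cuboid_def[of K]
    by (rule Collect_cong, rule conj_cong[OF refl], rule eq)
qed

lemma product_map_PiE:
  assumes "\<And>k. k \<in> K \<Longrightarrow> f k \<in> I k \<rightarrow> J k"
  shows "product_map K f \<in> PiE K I \<rightarrow> PiE K J"
proof
  fix x assume "x \<in> PiE K I"
  then have "f k (x k) \<in> J k" if "k \<in> K" for k
    using funcset_mem[OF assms[OF that]] PiE_mem[of x K I k] that by simp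
  then show "product_map K f x \<in> PiE K J"
    unfolding product_map_def by (simp only: restrict_PiE_iff) simp
qed

text \<open>
  The sides of the image are the images of the sides, so each tuple in the box spanned by the image is
  the image of a tuple in the original box.
\<close>

lemma product_map_cuboid:
  assumes f: "\<And>k. k \<in> K \<Longrightarrow> f k \<in> I k \<rightarrow> J k"
    and RS: "product_map K f ` R \<subseteq> S" and \<rho>: "\<rho> \<in> cuboid K I R"
  shows "product_map K f ` \<rho> \<in> cuboid K J S"
proof -
  have \<rho>': "\<rho> \<subseteq> PiE K I" "finite \<rho>" "\<rho> \<noteq> {}" "PiE K (\<lambda>k. (\<lambda>x. x k) ` \<rho>) \<subseteq> R"
    using \<rho> by (auto simp: cuboid_def nonempty_finite_subsets_def)
  have "z \<in> S" if z: "z \<in> PiE K (\<lambda>k. (\<lambda>x. x k) ` product_map K f ` \<rho>)" for z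
  proof -
    have "\<exists>a\<in>(\<lambda>x. x k) ` \<rho>. z k = f k a" if "k \<in> K" for k
      using PiE_mem[OF z that] that by (auto simp: product_map_def)
    then obtain y where y: "\<And>k. k \<in> K \<Longrightarrow> y k \<in> (\<lambda>x. x k) ` \<rho> \<and> z k = f k (y k)"
      by metis
    have "restrict y K \<in> PiE K (\<lambda>k. (\<lambda>x. x k) ` \<rho>)"
      using y by (simp add: restrict_PiE_iff)
    then have "restrict y K \<in> R" using \<rho>'(4) by blast
    moreover have "product_map K f (restrict y K) = z"
    proof
      fix k show "product_map K f (restrict y K) k = z k"
        using y[of k] PiE_arb[OF z, of k] by (cases "k \<in> K") (simp_all add: product_map_def)
    qed
    ultimately show "z \<in> S" using RS by blast
  qed
  moreover have "product_map K f ` \<rho> \<in> nonempty_finite_subsets (PiE K J)"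
    using \<rho> unfolding cuboid_def
    by (intro image_nonempty_finite_subsets[OF product_map_PiE[OF f]]) (simp_all only: mem_Collect_eq)
  ultimately show ?thesis
    unfolding cuboid_def mem_Collect_eq by (intro conjI subsetI)
qed

lemma simplicial_map_cuboid:
  assumes "\<And>k. k \<in> K \<Longrightarrow> f k \<in> I k \<rightarrow> J k" "product_map K f ` R \<subseteq> S"
  shows "simplicial_map (PiE K I) (cuboid K I R) (PiE K J) (cuboid K J S) (product_map K f)"
  unfolding simplicial_map_def
  using product_map_PiE[of K f I J, OF assms(1)] product_map_cuboid[of K f I J, OF assms]
  by (simp add: abstract_complex_on_cuboid)

lemma product_map_upd:
  assumes "k \<in> K"
  shows "product_map K f (y(k := i)) = (product_map (K - {k}) f y)(k := f k i)"
  using assms by (auto simp: product_map_def fun_eq_iff)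

text \<open>
  Together with \<open>product_map_cuboid\<close> in the remaining positions, this reduces functoriality of the Dowker
  complexes to that of the cuboid complexes.
\<close>

lemma product_map_slice:
  assumes k: "k \<in> K" and f: "\<And>k. k \<in> K \<Longrightarrow> f k \<in> I k \<rightarrow> J k"
    and RS: "product_map K f ` R \<subseteq> S"
  shows "product_map (K - {k}) f ` slice K I R k i \<subseteq> slice K J S k (f k i)"
proof -
  have maps: "product_map (K - {k}) f \<in> PiE (K - {k}) I \<rightarrow> PiE (K - {k}) J"
    using f by (intro product_map_PiE) simp
  show ?thesis
  proof (rule image_subsetI)
    fix y assume "y \<in> slice K I R k i"
    then have y: "y \<in> PiE (K - {k}) I" "y(k := i) \<in> R"
      by (simp_all add: slice_def)
    have "product_map K f (y(k := i)) \<in> S"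
      using RS y(2) by blast
    then have "(product_map (K - {k}) f y)(k := f k i) \<in> S"
      by (simp only: product_map_upd[OF k])
    then show "product_map (K - {k}) f y \<in> slice K J S k (f k i)"
      using funcset_mem[OF maps y(1)] by (simp add: slice_def)
  qed
qed

lemma simplicial_map_dowker:
  assumes k: "k \<in> K" and f: "\<And>k. k \<in> K \<Longrightarrow> f k \<in> I k \<rightarrow> J k"
    and RS: "product_map K f ` R \<subseteq> S"
  shows "simplicial_map (PiE (K - {k}) I) (dowker K I R k) (PiE (K - {k}) J) (dowker K J S k)
    (product_map (K - {k}) f)"
  unfolding simplicial_map_def
proof (intro conjI ballI abstract_complex_on_dowker)
  have f': "\<And>j. j \<in> K - {k} \<Longrightarrow> f j \<in> I j \<rightarrow> J j" using f by simp
  show "product_map (K - {k}) f \<in> PiE (K - {k}) I \<rightarrow> PiE (K - {k}) J"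
    by (rule product_map_PiE[OF f'])
  fix \<sigma> assume "\<sigma> \<in> dowker K I R k"
  then obtain i where i: "i \<in> I k" "\<sigma> \<in> cuboid (K - {k}) I (slice K I R k i)"
    by (auto simp: dowker_def)
  have "product_map (K - {k}) f ` \<sigma> \<in> cuboid (K - {k}) J (slice K J S k (f k i))"
    by (rule product_map_cuboid[OF f' product_map_slice[OF k f RS] i(2)])
  moreover have "f k i \<in> J k" using f[OF k] i(1) by blast
  ultimately show "product_map (K - {k}) f ` \<sigma> \<in> dowker K J S k"
    unfolding dowker_def by blast
qed

lemma omit_product_map:
  "omit K k (product_map K f x) = product_map (K - {k}) f (omit K k x)"
  by (auto simp: omit_def product_map_def fun_eq_iff)

lemma omit_surjective_simplicial_map:
  assumes k: "k \<in> K"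
  shows "surjective_simplicial_map (PiE K I) (cuboid K I R)
    (PiE (K - {k}) I) (dowker K I R k) (omit K k)"
  unfolding cuboid_eq_cover_complex[OF k] dowker_def
  by (rule cover_complex_surjective[OF bij_betw_omit_coordinate[OF k] abstract_complex_on_cuboid])

lemma omit_homotopy_equivalence:
  assumes k: "k \<in> K"
  shows "homotopy_equivalence_map (realization (cuboid K I R)) (realization (dowker K I R k))
    (realization_map (omit K k))"
  unfolding cuboid_eq_cover_complex[OF k] dowker_def
  by (rule homotopy_equivalence_cover_complex[OF bij_betw_omit_coordinate[OF k] abstract_complex_on_cuboid])

theorem theorem5p3p9:
  fixes m :: nat and I :: "nat \<Rightarrow> 'a set" and R :: "(nat \<Rightarrow> 'a) set"
  assumes "R \<subseteq> PiE {1..m} I"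
  shows "(\<forall>k\<in>{1..m}.
            surjective_simplicial_map
              (PiE {1..m} I) (cuboid {1..m} I R)
              (PiE ({1..m} - {k}) I) (dowker {1..m} I R k)
              (omit {1..m} k) \<and>
            homotopy_equivalence_map
              (realization (cuboid {1..m} I R)) (realization (dowker {1..m} I R k))
              (realization_map (omit {1..m} k))) \<and>
         (\<forall>(J :: nat \<Rightarrow> 'b set) S f.
            S \<subseteq> PiE {1..m} J \<and>
            (\<forall>k\<in>{1..m}. f k \<in> I k \<rightarrow> J k) \<and>
            product_map {1..m} f ` R \<subseteq> S \<longrightarrow>
            simplicial_map
              (PiE {1..m} I) (cuboid {1..m} I R)
              (PiE {1..m} J) (cuboid {1..m} J S)
              (product_map {1..m} f) \<and>
            (\<forall>k\<in>{1..m}.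
               simplicial_map
                 (PiE ({1..m} - {k}) I) (dowker {1..m} I R k)
                 (PiE ({1..m} - {k}) J) (dowker {1..m} J S k)
                 (product_map ({1..m} - {k}) f) \<and>
               (\<forall>x\<in>PiE {1..m} I.
                  omit {1..m} k (product_map {1..m} f x) =
                  product_map ({1..m} - {k}) f (omit {1..m} k x))))"
proof (intro conjI ballI allI impI)
  fix J :: "nat \<Rightarrow> 'b set" and S f
  assume "S \<subseteq> PiE {1..m} J \<and> (\<forall>k\<in>{1..m}. f k \<in> I k \<rightarrow> J k) \<and> product_map {1..m} f ` R \<subseteq> S"
  then have f: "\<And>k. k \<in> {1..m} \<Longrightarrow> f k \<in> I k \<rightarrow> J k" and RS: "product_map {1..m} f ` R \<subseteq> S"
    by blast+
  show "simplicial_map (PiE {1..m} I) (cuboid {1..m} I R) (PiE {1..m} J) (cuboid {1..m} J S)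
      (product_map {1..m} f)"
    by (rule simplicial_map_cuboid[OF f RS])
  show "simplicial_map (PiE ({1..m} - {k}) I) (dowker {1..m} I R k)
      (PiE ({1..m} - {k}) J) (dowker {1..m} J S k) (product_map ({1..m} - {k}) f)"
    if "k \<in> {1..m}" for k
    by (rule simplicial_map_dowker[OF that f RS])
qed (simp_all only: omit_product_map omit_surjective_simplicial_map omit_homotopy_equivalence)

end
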